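(* Let $\mu,\nu$ be Borel probability measures on $\mathbb R$ with finite first moments. Then the set $$\Pi^*(\mu,\nu)=\operatorname*{argmin}_{\pi\in\Pi(\mu,\nu)}\int_{\mathbb R}\Big|x-\int_{\mathbb R}y\,\pi_x(dy)\Big|\,\mu(dx)$$ is convex and compact with respect to the weak topology (induced by continuous bounded functions on $\mathbb R^2$).
   Context: $\Pi(\mu,\nu)$ is the set of Borel probability measures on $\mathbb R^2$ with first marginal $\mu$ and second marginal $\nu$; for $\pi\in\Pi(\mu,\nu)$, $(\pi_x)_{x\in\mathbb R}$ is the $\mu$-a.s. unique family of probability measures with $\pi(dx,dy)=\mu(dx)\pi_x(dy)$. *)

theory Defs
  imports "HOL-Probability.Probability"
begin

definition borel_probs :: "'a::topological_space measure set" where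
  "borel_probs = {\<pi>. prob_space \<pi> \<and> sets \<pi> = sets borel}"

(* Coarsest topology on the Borel probability measures for which \<pi> \<mapsto> \<integral>f d\<pi> is
   continuous for every bounded continuous f. *)
definition weak_topology :: "'a::topological_space measure topology" where
  "weak_topology = topology_generated_by
     {{\<pi> \<in> borel_probs. (\<integral>z. f z \<partial>\<pi>) \<in> U} | (f :: 'a \<Rightarrow> real) U.
        continuous_on UNIV f \<and> bounded (range f) \<and> open U}"

lemma topspace_weak_topology:
  "topspace (weak_topology :: 'a::topological_space measure topology) = borel_probs"
proof -
  have "\<exists>(f :: 'a \<Rightarrow> real) U. borel_probs = {\<pi> \<in> borel_probs. (\<integral>z. f z \<partial>\<pi>) \<in> U} \<and>
          continuous_on UNIV f \<and> bounded (range f) \<and> open U"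
    by (rule exI[of _ "\<lambda>_. 0"], rule exI[of _ UNIV]) auto
  then show ?thesis
    unfolding weak_topology_def topology_generated_by_topspace by blast
qed

definition mixture :: "real \<Rightarrow> 'a::topological_space measure \<Rightarrow> 'a measure \<Rightarrow> 'a measure" where
  "mixture t \<pi> \<rho> = measure_of UNIV (sets borel)
     (\<lambda>C. ennreal (1 - t) * emeasure \<pi> C + ennreal t * emeasure \<rho> C)"

lemma sets_mixture [simp]: "sets (mixture t \<pi> \<rho>) = sets borel"
  unfolding mixture_def using sets.sets_measure_of_eq[of borel] by simp

lemma emeasure_mixture:
  fixes \<pi> \<rho> :: "'a::topological_space measure"
  assumes "sets \<pi> = sets borel" "sets \<rho> = sets borel" "C \<in> sets borel"
  shows "emeasure (mixture t \<pi> \<rho>) C = ennreal (1 - t) * emeasure \<pi> C + ennreal t * emeasure \<rho> C"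
  unfolding mixture_def
proof (rule emeasure_measure_of_sigma)
  show "sigma_algebra (UNIV :: 'a set) (sets borel)"
    using sets.sigma_algebra_axioms[of "borel :: 'a measure"] by simp
  show "positive (sets borel) (\<lambda>C. ennreal (1 - t) * emeasure \<pi> C + ennreal t * emeasure \<rho> C)"
    by (simp add: positive_def)
  show "countably_additive (sets borel)
          (\<lambda>C. ennreal (1 - t) * emeasure \<pi> C + ennreal t * emeasure \<rho> C)"
    using assms(1,2)
    by (auto intro!: countably_additiveI
        simp: suminf_emeasure suminf_add[symmetric] image_subset_iff)
qed (fact assms(3))

definition convex_measures :: "'a::topological_space measure set \<Rightarrow> bool" where
  "convex_measures S \<longleftrightarrow> (\<forall>\<pi>\<in>S. \<forall>\<rho>\<in>S. \<forall>t\<in>{0..1}. mixture t \<pi> \<rho> \<in> S)"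

definition couplings :: "real measure \<Rightarrow> real measure \<Rightarrow> (real \<times> real) measure set" where
  "couplings \<mu> \<nu> = {\<pi> \<in> borel_probs. distr \<pi> borel fst = \<mu> \<and> distr \<pi> borel snd = \<nu>}"

definition is_disintegration ::
  "real measure \<Rightarrow> (real \<times> real) measure \<Rightarrow> (real \<Rightarrow> real measure) \<Rightarrow> bool" where
  "is_disintegration \<mu> \<pi> \<kappa> \<longleftrightarrow> \<kappa> \<in> borel \<rightarrow>\<^sub>M prob_algebra borel \<and>
     (\<forall>C \<in> sets borel. emeasure \<pi> C = (\<integral>\<^sup>+x. (\<integral>\<^sup>+y. indicator C (x, y) \<partial>\<kappa> x) \<partial>\<mu>))"

(* The kernel exists and is unique up to a \<mu>-null set for every coupling \<pi> with first
   marginal \<mu>, so martingale_cost does not depend on the choice made here. *)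
definition disintegration ::
  "real measure \<Rightarrow> (real \<times> real) measure \<Rightarrow> real \<Rightarrow> real measure" where
  "disintegration \<mu> \<pi> = (SOME \<kappa>. is_disintegration \<mu> \<pi> \<kappa>)"

(* If \<mu> and the second marginal of \<pi> have finite first moments, both Bochner integrals are
   proper: y is \<pi>\<^sub>x-integrable for \<mu>-almost every x, and the outer integrand is \<mu>-integrable. *)
definition martingale_cost :: "real measure \<Rightarrow> (real \<times> real) measure \<Rightarrow> real" where
  "martingale_cost \<mu> \<pi> = (\<integral>x. \<bar>x - (\<integral>y. y \<partial>disintegration \<mu> \<pi> x)\<bar> \<partial>\<mu>)"

definition optimal_couplings :: "real measure \<Rightarrow> real measure \<Rightarrow> (real \<times> real) measure set" where
  "optimal_couplings \<mu> \<nu> =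
     {\<pi>. is_arg_min (martingale_cost \<mu>) (\<lambda>\<pi>. \<pi> \<in> couplings \<mu> \<nu>) \<pi>}"

end

theory Submission
  imports Defs
begin

text \<open>
  Two facts carry the theorem: the couplings of \<open>\<mu>\<close> and \<open>\<nu>\<close> form a continuous image of a compact
  space, and the cost is a supremum of functionals that are affine and continuous there.

  The compact space consists of the bimeasures of \<open>\<mu>\<close> and \<open>\<nu>\<close>: functions \<open>\<beta>\<close> of a pair of sets that
  are additive in each argument and have \<open>\<mu>\<close> and \<open>\<nu>\<close> as marginals. They are cut out of a product of
  copies of \<open>[0, 1]\<close> by conditions on finitely many coordinates each, so Tychonoff's theorem gives
  compactness (\<open>compact_bimeasures\<close>). Countable additivity in each argument comes for free, because
  \<open>\<beta> (A, B)\<close> is dominated by both \<open>\<mu> A\<close> and \<open>\<nu> B\<close>. For each rational \<open>q\<close>, the measure \<open>\<beta> (\<cdot>, {..q})\<close>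
  therefore has a density with respect to \<open>\<mu>\<close>; these densities are, for almost every point, the values
  of a distribution function at the rationals, and so assemble into a probability kernel. Hence every
  bimeasure comes from a coupling (\<open>coupling_of_bimeasure\<close>), and the kernel disintegrates it. Applied
  to the bimeasure of a given coupling, the same construction shows that disintegrations exist
  (\<open>is_disintegration_disintegration\<close>), so that the cost has its intended meaning.

  The map from bimeasures to couplings is continuous for the weak topology. On a large square a
  bounded continuous function is close to a step function on a grid, whose integral is a finite
  combination of values of \<open>\<beta>\<close>, and what lies outside the square is controlled by the marginals alone,
  uniformly over all couplings (\<open>continuous_map_coupling_of\<close>).

  If \<open>m x\<close> is the barycentre of the kernel at \<open>x\<close>, then the integral of \<open>\<bar>x - m x\<bar>\<close> is the maximum of
  the integrals of \<open>s x * (x - m x)\<close> over all measurable signs \<open>s\<close>. Each of them equals the integral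
  of \<open>s x * (x - y)\<close> against the coupling, in which the kernel no longer occurs
  (\<open>martingale_cost_le_iff\<close>). This functional is affine in the coupling and, as \<open>\<nu>\<close> has a first
  moment, continuous in the bimeasure. Hence the sublevel sets of the cost are convex and compact,
  and the set of minimisers is empty or a sublevel set.
\<close>

section \<open>Kernels from distribution functions on the rationals\<close>

text \<open>
  The infimum from the right makes a monotone function on the rationals right continuous, at the price
  of possibly changing its value at each rational. The second part says what survives: the new
  function is the limit of the old one along rationals decreasing strictly to the point.
\<close>

lemma real_distribution_of_rational_cdf:
  fixes h :: "rat \<Rightarrow> real"
  assumes mono: "mono h"
    and top: "(\<lambda>n. h (of_nat n)) \<longlonglongrightarrow> 1"
    and bot: "(\<lambda>n. h (- of_nat n)) \<longlonglongrightarrow> 0"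
  defines "F \<equiv> \<lambda>b. INF q\<in>{q. b < real_of_rat q}. h q"
  shows "real_distribution (interval_measure F)"
    and "\<And>r b. (\<And>n. b < real_of_rat (r n)) \<Longrightarrow> (\<lambda>n. real_of_rat (r n)) \<longlonglongrightarrow> b
           \<Longrightarrow> (\<lambda>n. h (r n)) \<longlonglongrightarrow> measure (interval_measure F) {..b}"
proof -
  have h0: "0 \<le> h q" for q
  proof -
    obtain n where "- q \<le> of_nat n"
      using real_arch_simple by blast
    then have "h (- of_nat m) \<le> h q" if "n \<le> m" for m
    proof (intro monoD[OF mono])
      show "- of_nat m \<le> q"
        using \<open>- q \<le> of_nat n\<close> that by (subst minus_le_iff) (rule order_trans, assumption, simp)
    qed
    then show ?thesis
      by (intro LIMSEQ_le_const2[OF bot]) auto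
  qed
  have h1: "h q \<le> 1" for q
  proof -
    obtain n where "q \<le> of_nat n"
      using real_arch_simple by blast
    then have "h q \<le> h (of_nat m)" if "n \<le> m" for m
    proof (intro monoD[OF mono])
      show "q \<le> of_nat m"
        using \<open>q \<le> of_nat n\<close> by (rule order_trans) (simp add: that)
    qed
    then show ?thesis
      by (intro LIMSEQ_le_const[OF top]) auto
  qed
  have ne: "\<exists>q. b < real_of_rat q" for b
    using of_rat_dense[of b "b + 1"] by auto
  have bdd: "bdd_below (h ` S)" for S
    using h0 by (intro bdd_belowI2[of _ 0]) auto
  have F_le: "F b \<le> h q" if "b < real_of_rat q" for b q
    unfolding F_def using that by (intro cINF_lower bdd) auto
  have F_ge: "c \<le> F b" if "\<And>q. b < real_of_rat q \<Longrightarrow> c \<le> h q" for b c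
    unfolding F_def using that ne by (intro cINF_greatest) auto
  have F_near: "\<exists>q. b < real_of_rat q \<and> h q < c" if "F b < c" for b c
    using F_ge[of b c] that by (meson not_le)
  have mono_F: "F x \<le> F y" if "x \<le> y" for x y
    using that by (intro F_ge F_le) auto
  have cont_F: "continuous (at_right a) F" for a
    unfolding continuous_within
  proof (rule order_tendstoI)
    fix c assume "c < F a"
    then show "\<forall>\<^sub>F x in at_right a. c < F x"
      unfolding eventually_at_right_field
      by (intro exI[of _ "a + 1"]) (auto intro: less_le_trans[OF _ mono_F])
  next
    fix c assume "F a < c"
    then obtain q where "a < real_of_rat q" "h q < c"
      using F_near by blast
    then show "\<forall>\<^sub>F x in at_right a. F x < c"
      unfolding eventually_at_right_field
      by (intro exI[of _ "real_of_rat q"]) (auto intro: le_less_trans F_le)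
  qed
  have F0: "0 \<le> F b" for b
    using h0 by (intro F_ge) auto
  have F1: "F b \<le> 1" for b
  proof -
    obtain q where "b < real_of_rat q" using ne by blast
    from order_trans[OF F_le[OF this] h1] show ?thesis .
  qed
  have lim_bot: "(F \<longlongrightarrow> 0) at_bot"
  proof (rule order_tendstoI)
    fix c :: real assume "0 < c"
    then obtain n where "h (- of_nat n) < c"
      using order_tendstoD(2)[OF bot] eventually_happens'[OF sequentially_bot] by blast
    then have "F x < c" if "x < - real n" for x
      using F_le[of x "- of_nat n"] that by (auto simp: of_rat_minus)
    then show "\<forall>\<^sub>F x in at_bot. F x < c"
      by (auto simp: eventually_at_bot_dense)
  qed (auto intro!: always_eventually less_le_trans[OF _ F0])
  have lim_top: "(F \<longlongrightarrow> 1) at_top"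
  proof (rule order_tendstoI)
    fix c :: real assume "c < 1"
    then obtain n where n: "c < h (of_nat n)"
      using order_tendstoD(1)[OF top] eventually_happens'[OF sequentially_bot] by blast
    have "h (of_nat n) \<le> F x" if "real n < x" for x
    proof (intro F_ge monoD[OF mono])
      fix q assume "x < real_of_rat q"
      then have "real_of_rat (of_nat n) \<le> real_of_rat q"
        using that by simp
      then show "of_nat n \<le> q"
        by (simp only: of_rat_less_eq)
    qed
    with n show "\<forall>\<^sub>F x in at_top. c < F x"
      by (auto simp: eventually_at_top_dense intro: less_le_trans)
  qed (auto intro!: always_eventually le_less_trans[OF F1])
  show "real_distribution (interval_measure F)"
    by (rule real_distribution_interval_measure) (fact mono_F cont_F lim_bot lim_top)+
  fix r b assume r: "\<And>n. b < real_of_rat (r n)" "(\<lambda>n. real_of_rat (r n)) \<longlonglongrightarrow> b"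
  have "(\<lambda>n. h (r n)) \<longlonglongrightarrow> F b"
  proof (rule order_tendstoI)
    fix c assume "c < F b"
    then show "\<forall>\<^sub>F n in sequentially. c < h (r n)"
      by (intro always_eventually allI less_le_trans[OF _ F_le[OF r(1)]])
  next
    fix c assume "F b < c"
    then obtain q where q: "b < real_of_rat q" "h q < c"
      using F_near by blast
    show "\<forall>\<^sub>F n in sequentially. h (r n) < c"
      using order_tendstoD(2)[OF r(2) q(1)]
    proof eventually_elim
      case (elim n)
      then have "r n \<le> q" by (simp add: of_rat_less less_imp_le)
      from monoD[OF mono this] q show ?case by simp
    qed
  qed
  also have "F b = measure (interval_measure F) {..b}"
    using measure_interval_measure_Iic[OF mono_F cont_F lim_bot] by simp
  finally show "(\<lambda>n. h (r n)) \<longlonglongrightarrow> measure (interval_measure F) {..b}" .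
qed

lemma rational_decreasing_to:
  obtains r :: "nat \<Rightarrow> rat"
  where "\<And>n. b < real_of_rat (r n)" "(\<lambda>n. real_of_rat (r n)) \<longlonglongrightarrow> b" "decseq r"
proof -
  have "\<exists>r. \<forall>n. (b < real_of_rat (r n) \<and> real_of_rat (r n) < b + inverse (real (Suc n))) \<and> r (Suc n) \<le> r n"
  proof (rule dependent_nat_choice)
    show "\<exists>q. b < real_of_rat q \<and> real_of_rat q < b + inverse (real (Suc 0))"
      by (rule of_rat_dense) simp
    fix q n assume q: "b < real_of_rat q \<and> real_of_rat q < b + inverse (real (Suc n))"
    obtain q' where "b < real_of_rat q'" "real_of_rat q' < min (real_of_rat q) (b + inverse (real (Suc (Suc n))))"
      using of_rat_dense[of b "min (real_of_rat q) (b + inverse (real (Suc (Suc n))))"] q by auto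
    then show "\<exists>q'. (b < real_of_rat q' \<and> real_of_rat q' < b + inverse (real (Suc (Suc n)))) \<and> q' \<le> q"
      by (intro exI[of _ q']) (auto simp: of_rat_less less_imp_le)
  qed
  then obtain r where r: "\<And>n. b < real_of_rat (r n)" "\<And>n. real_of_rat (r n) < b + inverse (real (Suc n))"
      "\<And>n. r (Suc n) \<le> r n"
    by blast
  have "(\<lambda>n. real_of_rat (r n)) \<longlonglongrightarrow> b"
  proof (rule tendsto_sandwich[OF _ _ tendsto_const])
    show "(\<lambda>n. b + inverse (real (Suc n))) \<longlonglongrightarrow> b"
      using tendsto_add[OF tendsto_const LIMSEQ_inverse_real_of_nat, of b] by simp
  qed (use r in \<open>auto simp: less_imp_le\<close>)
  with r show thesis
    by (intro that[of r]) (auto simp: decseq_Suc_iff)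
qed

text \<open>
  Only countably many almost sure conditions are involved, so they hold simultaneously off one null
  set. There the distribution function of the point mass at 0 takes over, which makes the kernel
  a probability measure at every point.
\<close>

lemma prob_kernel_of_rational_cdfs:
  fixes f :: "rat \<Rightarrow> 'a \<Rightarrow> real"
  assumes [measurable]: "\<And>q. f q \<in> borel_measurable M"
    and mono: "\<And>q r. q \<le> r \<Longrightarrow> AE x in M. f q x \<le> f r x"
    and top: "AE x in M. (\<lambda>n. f (of_nat n) x) \<longlonglongrightarrow> 1"
    and bot: "AE x in M. (\<lambda>n. f (- of_nat n) x) \<longlonglongrightarrow> 0"
  obtains \<kappa> where "\<kappa> \<in> M \<rightarrow>\<^sub>M prob_algebra borel"
    and "\<And>r b. (\<And>n. b < real_of_rat (r n)) \<Longrightarrow> (\<lambda>n. real_of_rat (r n)) \<longlonglongrightarrow> b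
           \<Longrightarrow> AE x in M. (\<lambda>n. f (r n) x) \<longlonglongrightarrow> measure (\<kappa> x) {..b}"
proof -
  define G where "G = {x \<in> space M. (\<forall>q r. q \<le> r \<longrightarrow> f q x \<le> f r x) \<and>
      (\<lambda>n. f (of_nat n) x) \<longlonglongrightarrow> 1 \<and> (\<lambda>n. f (- of_nat n) x) \<longlonglongrightarrow> 0}"
  have [measurable]: "G \<in> sets M"
    unfolding G_def by measurable
  have "AE x in M. \<forall>q r. q \<le> r \<longrightarrow> f q x \<le> f r x"
    using mono by (auto simp: AE_all_countable)
  then have AE_G: "AE x in M. x \<in> G"
    using top bot AE_space by eventually_elim (auto simp: G_def)
  define g where "g x q = (if x \<in> G then f q x else if 0 \<le> q then 1 else 0)" for x q
  have [measurable]: "(\<lambda>x. g x q) \<in> borel_measurable M" for q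
    unfolding g_def by measurable
  have "mono (g x)" for x
    by (auto simp: mono_def g_def G_def)
  moreover have "(\<lambda>n. g x (of_nat n)) \<longlonglongrightarrow> 1" for x
  proof (cases "x \<in> G")
    case True
    then have "(\<lambda>n. f (of_nat n) x) \<longlonglongrightarrow> 1" by (simp add: G_def)
    with True show ?thesis by (simp add: g_def)
  qed (simp add: g_def)
  moreover have "(\<lambda>n. g x (- of_nat n)) \<longlonglongrightarrow> 0" for x
  proof (cases "x \<in> G")
    case False
    then have "\<forall>\<^sub>F n in sequentially. g x (- of_nat n) = 0"
      by (auto simp: g_def eventually_sequentially intro!: exI[of _ 1])
    then show ?thesis by (rule tendsto_eventually)
  next
    case True
    then have "(\<lambda>n. f (- of_nat n) x) \<longlonglongrightarrow> 0" by (simp add: G_def)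
    with True show ?thesis by (simp add: g_def)
  qed
  ultimately have g: "mono (g x)" "(\<lambda>n. g x (of_nat n)) \<longlonglongrightarrow> 1"
      "(\<lambda>n. g x (- of_nat n)) \<longlonglongrightarrow> 0" for x
    by auto
  define \<kappa> where "\<kappa> x = interval_measure (\<lambda>b. INF q\<in>{q. b < real_of_rat q}. g x q)" for x
  note \<kappa> = real_distribution_of_rational_cdf[OF g, folded \<kappa>_def]
  have "\<kappa> \<in> M \<rightarrow>\<^sub>M prob_algebra borel"
  proof (rule measurable_prob_algebra_generated)
    show "sets borel = sigma_sets UNIV (range (atMost :: real \<Rightarrow> real set))"
      unfolding borel_eq_atMost by simp
    show "Int_stable (range (atMost :: real \<Rightarrow> real set))"
      by (auto simp: Int_stable_def)
    fix x show "prob_space (\<kappa> x)" "sets (\<kappa> x) = sets borel"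
      using \<kappa>(1)[of x] by (auto simp: real_distribution_def real_distribution_axioms_def)
  next
    fix A assume "A \<in> range (atMost :: real \<Rightarrow> real set)"
    then obtain b where A: "A = {..b}" by auto
    obtain r where "\<And>n. b < real_of_rat (r n)" "(\<lambda>n. real_of_rat (r n)) \<longlonglongrightarrow> b"
      using rational_decreasing_to by blast
    then have "(\<lambda>x. measure (\<kappa> x) A) \<in> borel_measurable M"
      unfolding A by (intro borel_measurable_LIMSEQ_real[OF \<kappa>(2)]) auto
    moreover have "emeasure (\<kappa> x) A = measure (\<kappa> x) A" for x
      using \<kappa>(1)[of x] by (simp add: real_distribution_def prob_space_def finite_measure.emeasure_eq_measure)
    ultimately show "(\<lambda>x. emeasure (\<kappa> x) A) \<in> borel_measurable M"
      by simp
  qed auto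
  moreover have "AE x in M. (\<lambda>n. f (r n) x) \<longlonglongrightarrow> measure (\<kappa> x) {..b}"
    if "\<And>n. b < real_of_rat (r n)" "(\<lambda>n. real_of_rat (r n)) \<longlonglongrightarrow> b" for r b
    using AE_G
  proof eventually_elim
    case (elim x)
    then show ?case using \<kappa>(2)[OF that, of x] by (simp add: g_def)
  qed
  ultimately show thesis by (rule that)
qed

section \<open>Bimeasures\<close>

text \<open>
  The values on non-measurable sets are arbitrary elements of \<open>[0, 1]\<close>; thus the bimeasures are a
  subset of the full power of \<open>[0, 1]\<close> rather than of a product over measurable rectangles.
  Additivity is stated for two sets, so that each condition is an equation between continuous
  functions of finitely many coordinates.
\<close>

definition bimeasures :: "'a measure \<Rightarrow> 'b measure \<Rightarrow> ('a set \<times> 'b set \<Rightarrow> real) set" where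
  "bimeasures M N = {\<beta>. (\<forall>p. 0 \<le> \<beta> p \<and> \<beta> p \<le> 1) \<and>
     (\<forall>A\<in>sets M. \<beta> (A, space N) = measure M A) \<and>
     (\<forall>B\<in>sets N. \<beta> (space M, B) = measure N B) \<and>
     (\<forall>A\<in>sets M. \<forall>A'\<in>sets M. \<forall>B\<in>sets N.
        A \<inter> A' = {} \<longrightarrow> \<beta> (A \<union> A', B) = \<beta> (A, B) + \<beta> (A', B)) \<and>
     (\<forall>A\<in>sets M. \<forall>B\<in>sets N. \<forall>B'\<in>sets N.
        B \<inter> B' = {} \<longrightarrow> \<beta> (A, B \<union> B') = \<beta> (A, B) + \<beta> (A, B'))}"

lemma compact_bimeasures: "compact (bimeasures M N)"
proof -
  have "compactin (product_topology (\<lambda>_. euclidean) UNIV)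
          (PiE UNIV (\<lambda>_. {0..1}) :: ('a set \<times> 'b set \<Rightarrow> real) set)"
    by (simp add: compactin_PiE)
  then have "compact (PiE UNIV (\<lambda>_. {0..1}) :: ('a set \<times> 'b set \<Rightarrow> real) set)"
    by (simp add: euclidean_product_topology)
  moreover have "closed (bimeasures M N)"
    unfolding bimeasures_def Ball_def
    by (intro closed_Collect_conj closed_Collect_all closed_Collect_imp closed_Collect_eq
        closed_Collect_le continuous_on_product_coordinates continuous_on_const continuous_on_add
        open_Collect_const)
  ultimately have "compact (PiE UNIV (\<lambda>_. {0..1}) \<inter> bimeasures M N)"
    by (rule compact_Int_closed)
  moreover have "bimeasures M N \<subseteq> PiE UNIV (\<lambda>_. {0..1})"
    by (auto simp: bimeasures_def)
  ultimately show ?thesis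
    by (simp add: Int_absorb1)
qed

lemma bimeasuresD:
  assumes "\<beta> \<in> bimeasures M N"
  shows bimeasure_nonneg: "0 \<le> \<beta> p"
    and bimeasure_le_1: "\<beta> p \<le> 1"
    and bimeasure_space2: "A \<in> sets M \<Longrightarrow> \<beta> (A, space N) = measure M A"
    and bimeasure_space1: "B \<in> sets N \<Longrightarrow> \<beta> (space M, B) = measure N B"
    and bimeasure_Un1: "A \<in> sets M \<Longrightarrow> A' \<in> sets M \<Longrightarrow> B \<in> sets N \<Longrightarrow> A \<inter> A' = {} \<Longrightarrow>
          \<beta> (A \<union> A', B) = \<beta> (A, B) + \<beta> (A', B)"
    and bimeasure_Un2: "A \<in> sets M \<Longrightarrow> B \<in> sets N \<Longrightarrow> B' \<in> sets N \<Longrightarrow> B \<inter> B' = {} \<Longrightarrow>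
          \<beta> (A, B \<union> B') = \<beta> (A, B) + \<beta> (A, B')"
  using assms unfolding bimeasures_def by blast+

lemma bimeasures_swap:
  assumes "\<beta> \<in> bimeasures M N"
  shows "(\<lambda>(B, A). \<beta> (A, B)) \<in> bimeasures N M"
  unfolding bimeasures_def by (simp add: bimeasuresD[OF assms] split: prod.split)

lemma bimeasure_Diff:
  assumes "\<beta> \<in> bimeasures M N" "A \<in> sets M" "B \<in> sets N" "B' \<in> sets N" "B \<subseteq> B'"
  shows "\<beta> (A, B') - \<beta> (A, B) = \<beta> (A, B' - B)"
proof -
  have "\<beta> (A, B \<union> (B' - B)) = \<beta> (A, B) + \<beta> (A, B' - B)"
    using assms by (intro bimeasure_Un2[OF assms(1)]) auto
  moreover have "B \<union> (B' - B) = B'" using assms by auto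
  ultimately show ?thesis by simp
qed

lemma bimeasure_mono2:
  assumes "\<beta> \<in> bimeasures M N" "A \<in> sets M" "B \<in> sets N" "B' \<in> sets N" "B \<subseteq> B'"
  shows "\<beta> (A, B) \<le> \<beta> (A, B')"
  using bimeasure_Diff[OF assms] bimeasure_nonneg[OF assms(1), of "(A, B' - B)"] by simp

lemma bimeasure_le1:
  assumes "\<beta> \<in> bimeasures M N" "A \<in> sets M" "B \<in> sets N"
  shows "\<beta> (A, B) \<le> measure M A"
  using bimeasure_mono2[OF assms sets.top sets.sets_into_space[OF assms(3)]]
    bimeasure_space2[OF assms(1,2)] by simp

lemma bimeasure_le2:
  assumes "\<beta> \<in> bimeasures M N" "A \<in> sets M" "B \<in> sets N"
  shows "\<beta> (A, B) \<le> measure N B"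
  using bimeasure_le1[OF bimeasures_swap[OF assms(1)] assms(3,2)] by simp

text \<open>
  Countable additivity is automatic: a finitely additive set function dominated by a finite measure is
  continuous at the empty set.
\<close>

lemma bimeasure_slice:
  assumes "finite_measure M" and \<beta>: "\<beta> \<in> bimeasures M N" and B: "B \<in> sets N"
  obtains L where "finite_measure L" "sets L = sets M"
    and "\<And>A. A \<in> sets M \<Longrightarrow> emeasure L A = ennreal (\<beta> (A, B))"
proof -
  interpret finite_measure M by fact
  define L where "L = measure_of (space M) (sets M) (\<lambda>A. ennreal (\<beta> (A, B)))"
  note nn = bimeasure_nonneg[OF \<beta>]
  have empty: "\<beta> ({}, B) = 0"
    using bimeasure_le1[OF \<beta> sets.empty_sets B] nn[of "({}, B)"] by simp
  have "countably_additive (sets M) (\<lambda>A. ennreal (\<beta> (A, B)))"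
  proof (rule sets.empty_continuous_imp_countably_additive)
    show "positive (sets M) (\<lambda>A. ennreal (\<beta> (A, B)))"
      by (simp add: positive_def empty)
    show "additive (sets M) (\<lambda>A. ennreal (\<beta> (A, B)))"
      using bimeasure_Un1[OF \<beta> _ _ B] nn by (simp add: additive_def)
    fix A :: "nat \<Rightarrow> 'a set" assume A: "range A \<subseteq> sets M" "decseq A" "(\<Inter>i. A i) = {}"
    have "(\<lambda>i. measure M (A i)) \<longlonglongrightarrow> measure M (\<Inter>i. A i)"
      by (rule finite_Lim_measure_decseq) fact+
    then have "(\<lambda>i. measure M (A i)) \<longlonglongrightarrow> 0"
      using A by simp
    then have "(\<lambda>i. \<beta> (A i, B)) \<longlonglongrightarrow> 0"
      by (rule tendsto_sandwich[OF _ _ tendsto_const, rotated 2])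
         (use A B bimeasure_le1[OF \<beta>] nn in auto)
    then show "(\<lambda>i. ennreal (\<beta> (A i, B))) \<longlonglongrightarrow> 0"
      using tendsto_ennrealI by fastforce
  qed simp
  then have L: "emeasure L A = ennreal (\<beta> (A, B))" if "A \<in> sets M" for A
    unfolding L_def using that
    by (intro emeasure_measure_of_sigma) (auto simp: positive_def empty sets.sigma_algebra_axioms)
  show thesis
  proof (rule that[of L])
    show "sets L = sets M" by (simp add: L_def)
    have "space L = space M" by (simp add: L_def)
    then show "finite_measure L" by (intro finite_measureI) (simp add: L)
  qed fact
qed

lemma bimeasure_density:
  assumes "finite_measure M" and \<beta>: "\<beta> \<in> bimeasures M N" and B: "B \<in> sets N"
  obtains f :: "'a \<Rightarrow> real" where "integrable M f"
    and "\<And>A. A \<in> sets M \<Longrightarrow> (LINT x:A|M. f x) = \<beta> (A, B)"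
proof -
  interpret finite_measure M by fact
  obtain L where L: "finite_measure L" "sets L = sets M"
    "\<And>A. A \<in> sets M \<Longrightarrow> emeasure L A = ennreal (\<beta> (A, B))"
    using bimeasure_slice[OF assms] by blast
  note nn = bimeasure_nonneg[OF \<beta>]
  have "absolutely_continuous M L"
    unfolding absolutely_continuous_def
  proof
    fix A assume A: "A \<in> null_sets M"
    then have "\<beta> (A, B) \<le> 0"
      using bimeasure_le1[OF \<beta> _ B, of A] by (simp add: measure_eq_0_null_sets null_setsD2)
    with A show "A \<in> null_sets L"
      by (simp add: L null_sets_def ennreal_eq_0_iff)
  qed
  then obtain f where f: "f \<in> borel_measurable M" "AE x in M. RN_deriv M L x = ennreal (f x)"
      "\<And>x. 0 \<le> f x"
    using real_RN_deriv[OF L(1) _ L(2)] by blast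
  note [measurable] = f(1)
  have "L = density M (RN_deriv M L)"
    using density_RN_deriv[OF \<open>absolutely_continuous M L\<close> L(2)] by simp
  also have "\<dots> = density M (\<lambda>x. ennreal (f x))"
    using f by (intro density_cong) auto
  finally have Lf: "L = density M (\<lambda>x. ennreal (f x))" .
  have *: "(\<integral>\<^sup>+x. ennreal (indicator A x * f x) \<partial>M) = ennreal (\<beta> (A, B))" if "A \<in> sets M" for A
  proof -
    have "(\<integral>\<^sup>+x. ennreal (indicator A x * f x) \<partial>M) = (\<integral>\<^sup>+x. ennreal (f x) * indicator A x \<partial>M)"
      by (intro nn_integral_cong) (auto simp: indicator_def)
    also have "\<dots> = emeasure L A"
      using that by (subst Lf) (simp add: emeasure_density)
    finally show ?thesis using L(3) that by simp
  qed
  show thesis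
  proof (rule that[of f])
    have "(\<integral>\<^sup>+x. ennreal (f x) \<partial>M) = (\<integral>\<^sup>+x. ennreal (indicator (space M) x * f x) \<partial>M)"
      by (intro nn_integral_cong) simp
    then show "integrable M f"
      using *[of "space M"] f by (intro integrableI_nonneg) auto
    fix A assume [measurable]: "A \<in> sets M"
    show "(LINT x:A|M. f x) = \<beta> (A, B)"
      unfolding set_lebesgue_integral_def
      by (subst integral_eq_nn_integral) (use f * nn in auto)
  qed
qed

text \<open>
  A monotone sequence has a limit, and by dominated convergence the limit has integral zero.
  For the densities of \<open>\<beta> (\<cdot>, {..q})\<close> this turns the behaviour of the marginal distribution function
  at infinity into the almost sure behaviour of the densities.
\<close>

lemma AE_tendsto_0_of_decseq:
  fixes f :: "nat \<Rightarrow> 'a \<Rightarrow> real"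
  assumes int: "\<And>n. integrable M (f n)"
    and dec: "AE x in M. decseq (\<lambda>n. f n x)"
    and nn: "\<And>n. AE x in M. 0 \<le> f n x"
    and lim: "(\<lambda>n. integral\<^sup>L M (f n)) \<longlonglongrightarrow> 0"
  shows "AE x in M. (\<lambda>n. f n x) \<longlonglongrightarrow> 0"
proof -
  have [measurable]: "f n \<in> borel_measurable M" for n
    using int by auto
  define g where "g x = lim (\<lambda>n. f n x)" for x
  have [measurable]: "g \<in> borel_measurable M"
    unfolding g_def by measurable
  have nn': "AE x in M. \<forall>n. 0 \<le> f n x"
    using nn by (simp add: AE_all_countable)
  have conv: "AE x in M. (\<lambda>n. f n x) \<longlonglongrightarrow> g x"
    using dec nn'
  proof eventually_elim
    case (elim x)
    then obtain l where "(\<lambda>n. f n x) \<longlonglongrightarrow> l"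
      using decseq_convergent[of "\<lambda>n. f n x" 0] by blast
    then have "convergent (\<lambda>n. f n x)"
      by (rule convergentI)
    then show ?case by (simp add: g_def convergent_LIMSEQ_iff)
  qed
  have bound: "AE x in M. norm (f n x) \<le> f 0 x" for n
    using dec nn' by eventually_elim (auto simp: decseq_def)
  have "integrable M g" and "(\<lambda>n. integral\<^sup>L M (f n)) \<longlonglongrightarrow> integral\<^sup>L M g"
    using integrable_dominated_convergence[OF _ _ int[of 0] conv bound]
      integral_dominated_convergence[OF _ _ int[of 0] conv bound] by auto
  moreover have g_nn: "AE x in M. 0 \<le> g x"
    using conv nn' by eventually_elim (auto intro: LIMSEQ_le_const)
  ultimately have "AE x in M. g x = 0"
    using LIMSEQ_unique[OF lim, of "integral\<^sup>L M g"] integral_nonneg_eq_0_iff_AE[of M g] by simp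
  with conv show ?thesis by eventually_elim simp
qed

text \<open>
  Let \<open>f q\<close> be the density of \<open>\<beta> (\<cdot>, {..q})\<close>. Additivity in the second argument makes \<open>f\<close> increasing
  in \<open>q\<close> almost surely, and its integrals are the values of the distribution function of \<open>N\<close>, which
  forces the limits 0 and 1. The right limits of \<open>f\<close> that define the kernel do not disturb the
  identity with \<open>\<beta>\<close>, because \<open>\<beta> (A, {b<..r})\<close> is at most \<open>N {b<..r}\<close>, which vanishes as \<open>r\<close>
  decreases to \<open>b\<close>.
\<close>

lemma bimeasure_kernel:
  assumes "prob_space M" "prob_space N" and N: "sets N = sets (borel :: real measure)"
    and \<beta>: "\<beta> \<in> bimeasures M N"
  obtains \<kappa> where "\<kappa> \<in> M \<rightarrow>\<^sub>M prob_algebra borel"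
    and "\<And>A b. A \<in> sets M \<Longrightarrow> (LINT x:A|M. measure (\<kappa> x) {..b}) = \<beta> (A, {..b})"
proof -
  interpret M: prob_space M by fact
  interpret N: real_distribution N
    using assms by (simp add: real_distribution_def real_distribution_axioms_def)
  have "\<exists>f. integrable M f \<and> (\<forall>A\<in>sets M. (LINT x:A|M. f x) = \<beta> (A, {..real_of_rat q}))" for q
    using bimeasure_density[OF M.finite_measure_axioms \<beta>, of "{..real_of_rat q}"] N
    by (metis atMost_borel)
  then obtain f where f: "\<And>q. integrable M (f q)"
      "\<And>q A. A \<in> sets M \<Longrightarrow> (LINT x:A|M. f q x) = \<beta> (A, {..real_of_rat q})"
    by metis
  \<comment> \<open>The bounds and the monotonicity of \<open>f\<close> are read off from its integrals over all measurable sets.\<close>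
  have total: "integral\<^sup>L M (f q) = cdf N (real_of_rat q)" for q
  proof -
    have "(LINT x:space M|M. f q x) = integral\<^sup>L M (f q)"
      unfolding set_lebesgue_integral_def by (intro Bochner_Integration.integral_cong) auto
    then show ?thesis
      using f(2)[of "space M" q] bimeasure_space1[OF \<beta>, of "{..real_of_rat q}"] N
      by (simp add: cdf_def)
  qed
  have diff: "(LINT x:A|M. u x - v x) = (LINT x:A|M. u x) - (LINT x:A|M. v x)"
    if "A \<in> sets M" "integrable M u" "integrable M v" for A and u v :: "'a \<Rightarrow> real"
    using that integrable_mult_indicator[of A M u] integrable_mult_indicator[of A M v]
    unfolding set_lebesgue_integral_def by (simp add: right_diff_distrib)
  have mono: "AE x in M. f q x \<le> f r x" if "q \<le> r" for q r
  proof -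
    have "0 \<le> (LINT x:A|M. f r x - f q x)" if "A \<in> sets M" for A
      using bimeasure_mono2[OF \<beta> that, of "{..real_of_rat q}" "{..real_of_rat r}"] \<open>q \<le> r\<close> N that
      by (simp add: diff f of_rat_less_eq)
    then have "AE x in M. 0 \<le> f r x - f q x"
      using f by (intro M.density_nonneg) auto
    then show ?thesis by eventually_elim simp
  qed
  have f_nn: "AE x in M. 0 \<le> f q x" for q
    using f bimeasure_nonneg[OF \<beta>] by (intro M.density_nonneg) auto
  have f_le: "AE x in M. 0 \<le> 1 - f q x" for q
  proof (rule M.density_nonneg)
    fix A assume A: "A \<in> sets M"
    have "(LINT x:A|M. (1::real)) = measure M A"
      using A by (simp add: set_lebesgue_integral_def)
    with A show "0 \<le> (LINT x:A|M. 1 - f q x)"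
      using bimeasure_le1[OF \<beta> A, of "{..real_of_rat q}"] N f by (subst diff) auto
  qed (use f in auto)
  have AE_mono: "AE x in M. \<forall>q r. q \<le> r \<longrightarrow> f q x \<le> f r x"
    using mono by (auto simp: AE_all_countable)
  have "AE x in M. (\<lambda>n. 1 - f (of_nat n) x) \<longlonglongrightarrow> 0"
  proof (rule AE_tendsto_0_of_decseq[OF _ _ f_le])
    show "AE x in M. decseq (\<lambda>n. 1 - f (of_nat n) x)"
      using AE_mono by eventually_elim (auto simp: decseq_def)
    have "(\<lambda>n. 1 - cdf N (real n)) \<longlonglongrightarrow> 1 - 1"
      by (intro tendsto_intros N.cdf_lim_infty_prob)
    then show "(\<lambda>n. LINT x|M. 1 - f (of_nat n) x) \<longlonglongrightarrow> 0"
      using f by (simp add: total M.prob_space)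
  qed (use f in auto)
  then have top: "AE x in M. (\<lambda>n. f (of_nat n) x) \<longlonglongrightarrow> 1"
    by eventually_elim (use tendsto_diff[OF tendsto_const, of _ 0 _ 1] in fastforce)
  have bot: "AE x in M. (\<lambda>n. f (- of_nat n) x) \<longlonglongrightarrow> 0"
  proof (rule AE_tendsto_0_of_decseq[OF _ _ f_nn])
    show "AE x in M. decseq (\<lambda>n. f (- of_nat n) x)"
      using AE_mono by eventually_elim (auto simp: decseq_def)
    show "(\<lambda>n. integral\<^sup>L M (f (- of_nat n))) \<longlonglongrightarrow> 0"
      using N.cdf_lim_neg_infty by (simp add: total of_rat_minus)
  qed (use f in auto)
  obtain \<kappa> where \<kappa>: "\<kappa> \<in> M \<rightarrow>\<^sub>M prob_algebra borel"
    "\<And>r b. (\<And>n. b < real_of_rat (r n)) \<Longrightarrow> (\<lambda>n. real_of_rat (r n)) \<longlonglongrightarrow> b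
           \<Longrightarrow> AE x in M. (\<lambda>n. f (r n) x) \<longlonglongrightarrow> measure (\<kappa> x) {..b}"
    using prob_kernel_of_rational_cdfs[OF borel_measurable_integrable[OF f(1)] mono top bot] by blast
  have [measurable]: "(\<lambda>x. measure (\<kappa> x) {..b}) \<in> borel_measurable M" for b
    using measurable_compose[OF measurable_prob_algebraD[OF \<kappa>(1)] measurable_measure_subprob_algebra]
    by simp
  have "(LINT x:A|M. measure (\<kappa> x) {..b}) = \<beta> (A, {..b})" if A [measurable]: "A \<in> sets M" for A b
  proof -
    obtain r :: "nat \<Rightarrow> rat" where r: "\<And>n. b < real_of_rat (r n)"
        "(\<lambda>n. real_of_rat (r n)) \<longlonglongrightarrow> b" "decseq r"
      using rational_decreasing_to by blast
    have lim1: "(\<lambda>n. LINT x:A|M. f (r n) x) \<longlonglongrightarrow> (LINT x:A|M. measure (\<kappa> x) {..b})"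
      unfolding set_lebesgue_integral_def
    proof (rule integral_dominated_convergence[where w = "\<lambda>_. 1"])
      show "AE x in M. (\<lambda>n. indicat_real A x *\<^sub>R f (r n) x)
              \<longlonglongrightarrow> indicat_real A x *\<^sub>R measure (\<kappa> x) {..b}"
        using \<kappa>(2)[OF r(1,2)] by eventually_elim (intro tendsto_intros)
      show "AE x in M. norm (indicat_real A x *\<^sub>R f (r n) x) \<le> 1" for n
        using f_nn[of "r n"] f_le[of "r n"] by eventually_elim (auto simp: indicator_def)
    qed (use f in auto)
    have lim2: "(\<lambda>n. LINT x:A|M. f (r n) x) \<longlonglongrightarrow> \<beta> (A, {..b})"
    proof (rule LIM_zero_cancel)
      have "(\<lambda>n. measure N {..real_of_rat (r n)}) \<longlonglongrightarrow> measure N (\<Inter>n. {..real_of_rat (r n)})"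
        using r(3) by (intro N.finite_Lim_measure_decseq) (auto simp: decseq_def of_rat_less_eq intro: order_trans)
      also have "(\<Inter>n. {..real_of_rat (r n)}) = {..b}"
        using r(1) by (auto intro: LIMSEQ_le_const[OF r(2)] order_trans[OF _ less_imp_le])
      finally have upper: "(\<lambda>n. measure N {..real_of_rat (r n)} - measure N {..b}) \<longlonglongrightarrow> 0"
        by (rule LIM_zero)
      have sub: "{..b} \<subseteq> {..real_of_rat (r n)}" for n
        using r(1)[of n] by auto
      have "(LINT x:A|M. f (r n) x) - \<beta> (A, {..b}) = \<beta> (A, {..real_of_rat (r n)} - {..b})" for n
        using bimeasure_Diff[OF \<beta> A _ _ sub] N f A by simp
      moreover have "\<beta> (A, {..real_of_rat (r n)} - {..b}) \<le> measure N ({..real_of_rat (r n)} - {..b})" for n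
        using N by (intro bimeasure_le2[OF \<beta> A]) auto
      moreover have "measure N ({..real_of_rat (r n)} - {..b})
          = measure N {..real_of_rat (r n)} - measure N {..b}" for n
        using sub by (intro N.finite_measure_Diff) auto
      ultimately have "0 \<le> (LINT x:A|M. f (r n) x) - \<beta> (A, {..b})"
          "(LINT x:A|M. f (r n) x) - \<beta> (A, {..b}) \<le> measure N {..real_of_rat (r n)} - measure N {..b}" for n
        using bimeasure_nonneg[OF \<beta>] by auto
      then show "(\<lambda>n. (LINT x:A|M. f (r n) x) - \<beta> (A, {..b})) \<longlonglongrightarrow> 0"
        by (intro tendsto_sandwich[OF _ _ tendsto_const upper] always_eventually allI)
    qed
    show ?thesis
      by (rule LIMSEQ_unique[OF lim1 lim2])
  qed
  with \<kappa>(1) show thesis by (rule that)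
qed

section \<open>Mixtures along a kernel\<close>

text \<open>
  For nonnegative functions this is \<open>nn_integral_bind\<close>. It is applied to the positive and the negative
  part, whose inner integrals are finite almost everywhere as the outer ones are finite.
  Unlike \<open>integral_bind\<close>, it covers unbounded functions such as the coordinates under a first-moment
  condition.
\<close>

lemma integral_bind_integrable:
  fixes f :: "'b \<Rightarrow> real"
  assumes K [measurable]: "K \<in> M \<rightarrow>\<^sub>M subprob_algebra N" and "space M \<noteq> {}"
    and f: "integrable (M \<bind> K) f"
  shows "AE x in M. integrable (K x) f"
    and "integrable M (\<lambda>x. integral\<^sup>L (K x) f)"
    and "integral\<^sup>L (M \<bind> K) f = (\<integral>x. integral\<^sup>L (K x) f \<partial>M)"
proof -
  have sets_K: "sets (M \<bind> K) = sets N"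
    using sets_bind[OF sets_kernel[OF K] \<open>space M \<noteq> {}\<close>] by simp
  have fN [measurable]: "f \<in> borel_measurable N"
    using borel_measurable_integrable[OF f] measurable_cong_sets[OF sets_K refl] by blast
  have fK: "f \<in> borel_measurable (K x)" if "x \<in> space M" for x
    using fN subprob_measurableD(3)[OF K that] by blast
  have meas: "(\<lambda>x. \<integral>\<^sup>+y. g y \<partial>K x) \<in> borel_measurable M" if "g \<in> borel_measurable N" for g
    using measurable_compose[OF K nn_integral_measurable_subprob_algebra[OF that]] .
  have bind: "(\<integral>\<^sup>+y. g y \<partial>(M \<bind> K)) = (\<integral>\<^sup>+x. \<integral>\<^sup>+y. g y \<partial>K x \<partial>M)" if "g \<in> borel_measurable N" for g
    using nn_integral_bind[OF that K] .
  have part: "integrable M (\<lambda>x. enn2real (\<integral>\<^sup>+y. ennreal (g y) \<partial>K x))"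
      "(\<integral>x. enn2real (\<integral>\<^sup>+y. ennreal (g y) \<partial>K x) \<partial>M) = enn2real (\<integral>\<^sup>+y. ennreal (g y) \<partial>(M \<bind> K))"
      "AE x in M. (\<integral>\<^sup>+y. ennreal (g y) \<partial>K x) \<noteq> \<infinity>"
    if g: "integrable (M \<bind> K) g" "g \<in> borel_measurable N" for g :: "'b \<Rightarrow> real"
  proof -
    note [measurable] = g(2)
    have fin: "(\<integral>\<^sup>+x. \<integral>\<^sup>+y. ennreal (g y) \<partial>K x \<partial>M) \<noteq> \<infinity>"
      using g by (subst bind[symmetric]) (auto simp: real_integrable_def)
    have [measurable]: "(\<lambda>x. \<integral>\<^sup>+y. ennreal (g y) \<partial>K x) \<in> borel_measurable M"
      by (rule meas) measurable
    show ae: "AE x in M. (\<integral>\<^sup>+y. ennreal (g y) \<partial>K x) \<noteq> \<infinity>"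
      using nn_integral_PInf_AE[OF _ fin] by simp
    have eq: "(\<integral>\<^sup>+x. ennreal (enn2real (\<integral>\<^sup>+y. ennreal (g y) \<partial>K x)) \<partial>M)
        = (\<integral>\<^sup>+x. \<integral>\<^sup>+y. ennreal (g y) \<partial>K x \<partial>M)"
      using ae by (intro nn_integral_cong_AE) (auto simp: less_top)
    show "integrable M (\<lambda>x. enn2real (\<integral>\<^sup>+y. ennreal (g y) \<partial>K x))"
      using eq fin by (intro integrableI_nonneg) (auto simp: less_top)
    show "(\<integral>x. enn2real (\<integral>\<^sup>+y. ennreal (g y) \<partial>K x) \<partial>M) = enn2real (\<integral>\<^sup>+y. ennreal (g y) \<partial>(M \<bind> K))"
      by (subst integral_eq_nn_integral) (auto simp: eq bind)
  qed
  note P = part[OF f fN]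
  have Q: "integrable M (\<lambda>x. enn2real (\<integral>\<^sup>+y. ennreal (- f y) \<partial>K x))"
      "(\<integral>x. enn2real (\<integral>\<^sup>+y. ennreal (- f y) \<partial>K x) \<partial>M) = enn2real (\<integral>\<^sup>+y. ennreal (- f y) \<partial>(M \<bind> K))"
      "AE x in M. (\<integral>\<^sup>+y. ennreal (- f y) \<partial>K x) \<noteq> \<infinity>"
    using part[of "\<lambda>y. - f y"] f by auto
  show ae: "AE x in M. integrable (K x) f"
    using P(3) Q(3) AE_space
    by eventually_elim (use fK in \<open>auto simp: real_integrable_def\<close>)
  have split: "AE x in M. integral\<^sup>L (K x) f
      = enn2real (\<integral>\<^sup>+y. ennreal (f y) \<partial>K x) - enn2real (\<integral>\<^sup>+y. ennreal (- f y) \<partial>K x)"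
    using ae by eventually_elim (rule real_lebesgue_integral_def)
  have [measurable]: "(\<lambda>x. integral\<^sup>L (K x) f) \<in> borel_measurable M"
    using measurable_compose[OF K integral_measurable_subprob_algebra[OF fN]] .
  note diff = Bochner_Integration.integrable_diff[OF P(1) Q(1)]
  show "integrable M (\<lambda>x. integral\<^sup>L (K x) f)"
    using split diff by (subst integrable_cong_AE[OF _ _ split]) auto
  have "(\<integral>x. integral\<^sup>L (K x) f \<partial>M) =
      (\<integral>x. enn2real (\<integral>\<^sup>+y. ennreal (f y) \<partial>K x) - enn2real (\<integral>\<^sup>+y. ennreal (- f y) \<partial>K x) \<partial>M)"
    using diff by (intro integral_cong_AE split) auto
  also have "\<dots> = enn2real (\<integral>\<^sup>+y. ennreal (f y) \<partial>(M \<bind> K)) - enn2real (\<integral>\<^sup>+y. ennreal (- f y) \<partial>(M \<bind> K))"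
    using P Q by simp
  also have "\<dots> = integral\<^sup>L (M \<bind> K) f"
    using real_lebesgue_integral_def[OF f] by simp
  finally show "integral\<^sup>L (M \<bind> K) f = (\<integral>x. integral\<^sup>L (K x) f \<partial>M)" by simp
qed

text \<open>
  For fixed \<open>A\<close> both sides are finite measures in \<open>B\<close>, and by \<open>bimeasure_kernel\<close> they have the same
  distribution function.
\<close>

lemma bimeasure_kernel_rectangle:
  assumes M: "prob_space M" and N: "prob_space N" "sets N = sets (borel :: real measure)"
    and \<beta>: "\<beta> \<in> bimeasures M N"
  obtains \<kappa> where "\<kappa> \<in> M \<rightarrow>\<^sub>M prob_algebra borel"
    and "\<And>A B. A \<in> sets M \<Longrightarrow> B \<in> sets borel \<Longrightarrow>
           (\<integral>\<^sup>+x. emeasure (\<kappa> x) B * indicator A x \<partial>M) = ennreal (\<beta> (A, B))"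
proof -
  interpret M: prob_space M by fact
  interpret N: prob_space N by fact
  obtain \<kappa> where \<kappa> [measurable]: "\<kappa> \<in> M \<rightarrow>\<^sub>M prob_algebra borel"
    and half_line: "\<And>A b. A \<in> sets M \<Longrightarrow> (LINT x:A|M. measure (\<kappa> x) {..b}) = \<beta> (A, {..b})"
    using bimeasure_kernel[OF M N \<beta>] by blast
  note \<kappa>' = measurable_prob_algebraD[OF \<kappa>]
  have [measurable]: "(\<lambda>x. measure (\<kappa> x) B) \<in> borel_measurable M" if "B \<in> sets borel" for B
    using measurable_compose[OF \<kappa>' measurable_measure_subprob_algebra[OF that]] .
  have [measurable]: "(\<lambda>x. emeasure (\<kappa> x) B) \<in> borel_measurable M" if "B \<in> sets borel" for B
    using measurable_compose[OF \<kappa>' measurable_emeasure_subprob_algebra[OF that]] .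
  have prob: "prob_space (\<kappa> x)" if "x \<in> space M" for x
    using measurable_space[OF \<kappa> that] by (simp add: space_prob_algebra)
  have "(\<integral>\<^sup>+x. emeasure (\<kappa> x) B * indicator A x \<partial>M) = ennreal (\<beta> (A, B))"
    if A [measurable]: "A \<in> sets M" and B: "B \<in> sets borel" for A B
  proof -
    obtain L where L: "finite_measure L" "sets L = sets N"
      "\<And>B. B \<in> sets N \<Longrightarrow> emeasure L B = ennreal (\<beta> (A, B))"
      using bimeasure_slice[OF N.finite_measure_axioms bimeasures_swap[OF \<beta>] A] by auto
    define L' where "L' = density M (indicator A) \<bind> \<kappa>"
    have L': "emeasure L' B = (\<integral>\<^sup>+x. emeasure (\<kappa> x) B * indicator A x \<partial>M)" if "B \<in> sets borel" for B
      unfolding L'_def using that \<kappa>' M.not_empty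
      by (subst emeasure_bind[where N = borel]) (auto simp: nn_integral_density mult.commute)
    have sets_L': "sets L' = sets borel"
      unfolding L'_def using sets_kernel[OF \<kappa>'] M.not_empty by (subst sets_bind[where N = borel]) auto
    have le_1: "(\<integral>\<^sup>+x. emeasure (\<kappa> x) B * indicator A x \<partial>M) \<le> 1" for B
    proof -
      have "(\<integral>\<^sup>+x. emeasure (\<kappa> x) B * indicator A x \<partial>M) \<le> (\<integral>\<^sup>+x. 1 \<partial>M)"
        using prob by (intro nn_integral_mono) (auto simp: indicator_def prob_space.emeasure_le_1)
      then show ?thesis by (simp add: M.emeasure_space_1)
    qed
    have fin: "finite_measure L'"
    proof (rule finite_measureI)
      have "space L' = UNIV" using sets_eq_imp_space_eq[OF sets_L'] by simp
      then show "emeasure L' (space L') \<noteq> \<infinity>"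
        using le_1[of UNIV] by (auto simp: L' top_unique)
    qed
    have "L' = L"
    proof (rule cdf_unique')
      show "finite_borel_measure L'" "finite_borel_measure L"
        using fin sets_L' L N by (auto simp: finite_borel_measure_def finite_borel_measure_axioms_def)
      show "cdf L' = cdf L"
      proof
        fix b
        have "emeasure L' {..b} = (\<integral>\<^sup>+x. ennreal (indicat_real A x *\<^sub>R measure (\<kappa> x) {..b}) \<partial>M)"
          using prob
          by (subst L') (auto intro!: nn_integral_cong
              simp: prob_space_def finite_measure.emeasure_eq_measure indicator_def)
        also have "\<dots> = ennreal (LINT x:A|M. measure (\<kappa> x) {..b})"
          unfolding set_lebesgue_integral_def
        proof (rule nn_integral_eq_integral)
          show "integrable M (\<lambda>x. indicat_real A x *\<^sub>R measure (\<kappa> x) {..b})"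
            using prob
            by (intro M.integrable_const_bound[where B = 1])
               (auto simp: indicator_def prob_space.prob_le_1)
        qed auto
        also have "\<dots> = emeasure L {..b}"
          using L(3)[of "{..b}"] N half_line A by simp
        finally show "cdf L' b = cdf L b"
          by (simp add: cdf_def measure_def)
      qed
    qed
    with L(3)[of B] L'[OF B] B N show ?thesis by simp
  qed
  with \<kappa> show thesis by (rule that)
qed

text \<open>
  A measure with a given disintegration is a mixture along a kernel: draw \<open>x\<close> from \<open>\<mu>\<close>, then \<open>y\<close> from
  \<open>\<kappa> x\<close>, and return \<open>(x, y)\<close>. In this form \<open>integral_bind_integrable\<close> applies to it.
\<close>

lemma is_disintegration_bind:
  assumes \<mu>: "prob_space \<mu>" "sets \<mu> = sets borel" and \<kappa>: "\<kappa> \<in> borel \<rightarrow>\<^sub>M prob_algebra borel"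
  defines "K \<equiv> \<lambda>x. distr (\<kappa> x) borel (Pair x)"
  shows "K \<in> \<mu> \<rightarrow>\<^sub>M prob_algebra borel"
    and "is_disintegration \<mu> (\<mu> \<bind> K) \<kappa>"
    and "sets \<pi> = sets borel \<Longrightarrow> is_disintegration \<mu> \<pi> \<kappa> \<Longrightarrow> \<pi> = \<mu> \<bind> K"
proof -
  interpret prob_space \<mu> by fact
  have borel_\<mu>: "measurable \<mu> L = measurable borel L" for L :: "'z measure"
    using \<mu> by (intro measurable_cong_sets) auto
  note [measurable] = \<kappa>
  show K: "K \<in> \<mu> \<rightarrow>\<^sub>M prob_algebra borel"
    unfolding K_def borel_\<mu>
    by (rule measurable_distr_prob_space2[where M = borel]) (auto simp: borel_prod)
  note K' = measurable_prob_algebraD[OF K]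
  have sets_\<kappa>: "sets (\<kappa> x) = sets borel" for x
    using measurable_space[OF \<kappa>, of x] by (simp add: space_prob_algebra)
  have em: "emeasure (\<mu> \<bind> K) C = (\<integral>\<^sup>+x. (\<integral>\<^sup>+y. indicator C (x, y) \<partial>\<kappa> x) \<partial>\<mu>)"
    if C: "C \<in> sets borel" for C
  proof -
    have "emeasure (K x) C = (\<integral>\<^sup>+y. indicator C (x, y) \<partial>\<kappa> x)" for x
    proof -
      have [measurable]: "Pair x \<in> \<kappa> x \<rightarrow>\<^sub>M (borel :: (real \<times> real) measure)"
        using sets_\<kappa> by (simp add: measurable_cong_sets[OF sets_\<kappa> refl])
      have "emeasure (K x) C = (\<integral>\<^sup>+z. indicator C z \<partial>K x)"
        using C by (simp add: K_def)
      also have "\<dots> = (\<integral>\<^sup>+y. indicator C (x, y) \<partial>\<kappa> x)"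
        unfolding K_def using C by (subst nn_integral_distr) auto
      finally show ?thesis .
    qed
    then show ?thesis
      using C K' not_empty by (subst emeasure_bind[where N = borel]) auto
  qed
  then show "is_disintegration \<mu> (\<mu> \<bind> K) \<kappa>"
    using \<kappa> by (simp add: is_disintegration_def)
  have "sets (\<mu> \<bind> K) = sets borel"
    using sets_kernel[OF K'] not_empty by (subst sets_bind[where N = borel]) auto
  then show "\<pi> = \<mu> \<bind> K" if "sets \<pi> = sets borel" "is_disintegration \<mu> \<pi> \<kappa>"
    using that em by (intro measure_eqI) (auto simp: is_disintegration_def)
qed

section \<open>Couplings and their disintegrations\<close>

locale real_marginals =
  \<mu>: prob_space \<mu> + \<nu>: prob_space \<nu> for \<mu> \<nu> :: "real measure" +
  assumes sets_\<mu> [simp, measurable_cong]: "sets \<mu> = sets borel"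
    and sets_\<nu> [simp, measurable_cong]: "sets \<nu> = sets borel"
    and first_moment_\<mu>: "integrable \<mu> (\<lambda>x. x)"
    and first_moment_\<nu>: "integrable \<nu> (\<lambda>y. y)"
begin

lemma space_marginals [simp]: "space \<mu> = UNIV" "space \<nu> = UNIV"
  using sets_eq_imp_space_eq[OF sets_\<mu>] sets_eq_imp_space_eq[OF sets_\<nu>] by auto

lemma couplingsD:
  assumes "\<pi> \<in> couplings \<mu> \<nu>"
  shows "prob_space \<pi>" "sets \<pi> = sets borel" "space \<pi> = UNIV"
    "distr \<pi> borel fst = \<mu>" "distr \<pi> borel snd = \<nu>"
    "fst \<in> \<pi> \<rightarrow>\<^sub>M borel" "snd \<in> \<pi> \<rightarrow>\<^sub>M borel"
proof -
  show *: "prob_space \<pi>" "sets \<pi> = sets borel" "distr \<pi> borel fst = \<mu>" "distr \<pi> borel snd = \<nu>"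
    using assms by (auto simp: couplings_def borel_probs_def)
  show "space \<pi> = UNIV"
    using sets_eq_imp_space_eq[OF *(2)] by simp
  show "fst \<in> \<pi> \<rightarrow>\<^sub>M borel" "snd \<in> \<pi> \<rightarrow>\<^sub>M borel"
    by (auto simp: measurable_cong_sets[OF *(2) refl] simp flip: borel_prod)
qed

lemma Times_borel: "A \<in> sets borel \<Longrightarrow> B \<in> sets borel \<Longrightarrow> A \<times> B \<in> sets (borel :: (real \<times> real) measure)"
  for A B :: "real set"
  by (metis borel_prod pair_measureI)

lemma integrable_fst_coupling:
  fixes g :: "real \<Rightarrow> real"
  assumes "\<pi> \<in> couplings \<mu> \<nu>" "integrable \<mu> g"
  shows "integrable \<pi> (\<lambda>z. g (fst z))" "(\<integral>z. g (fst z) \<partial>\<pi>) = (\<integral>x. g x \<partial>\<mu>)"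
proof -
  note \<pi> = couplingsD[OF assms(1)]
  have [measurable]: "g \<in> borel_measurable borel"
    using borel_measurable_integrable[OF assms(2)] by measurable
  have "integrable (distr \<pi> borel fst) g"
    using assms \<pi> by simp
  then show "integrable \<pi> (\<lambda>z. g (fst z))"
    using \<pi>(6) by (subst (asm) integrable_distr_eq) auto
  show "(\<integral>z. g (fst z) \<partial>\<pi>) = (\<integral>x. g x \<partial>\<mu>)"
    using integral_distr[OF \<pi>(6), of g] \<pi> by simp
qed

lemma integrable_snd_coupling:
  fixes g :: "real \<Rightarrow> real"
  assumes "\<pi> \<in> couplings \<mu> \<nu>" "integrable \<nu> g"
  shows "integrable \<pi> (\<lambda>z. g (snd z))" "(\<integral>z. g (snd z) \<partial>\<pi>) = (\<integral>y. g y \<partial>\<nu>)"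
proof -
  note \<pi> = couplingsD[OF assms(1)]
  have [measurable]: "g \<in> borel_measurable borel"
    using borel_measurable_integrable[OF assms(2)] by measurable
  have "integrable (distr \<pi> borel snd) g"
    using assms \<pi> by simp
  then show "integrable \<pi> (\<lambda>z. g (snd z))"
    using \<pi>(7) by (subst (asm) integrable_distr_eq) auto
  show "(\<integral>z. g (snd z) \<partial>\<pi>) = (\<integral>y. g y \<partial>\<nu>)"
    using integral_distr[OF \<pi>(7), of g] \<pi> by simp
qed

text \<open>
  The kernel of \<open>bimeasure_kernel_rectangle\<close> and the first marginal determine the measure; its
  marginals are read off from rectangles with one full side.
\<close>

lemma coupling_of_bimeasure:
  assumes "\<beta> \<in> bimeasures \<mu> \<nu>"
  obtains \<pi> \<kappa> where "\<pi> \<in> couplings \<mu> \<nu>" "is_disintegration \<mu> \<pi> \<kappa>"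
    and "\<And>A B. A \<in> sets borel \<Longrightarrow> B \<in> sets borel \<Longrightarrow> measure \<pi> (A \<times> B) = \<beta> (A, B)"
proof -
  note nn = bimeasure_nonneg[OF assms]
  obtain \<kappa> where \<kappa>: "\<kappa> \<in> \<mu> \<rightarrow>\<^sub>M prob_algebra borel"
    "\<And>A B. A \<in> sets \<mu> \<Longrightarrow> B \<in> sets borel \<Longrightarrow>
           (\<integral>\<^sup>+x. emeasure (\<kappa> x) B * indicator A x \<partial>\<mu>) = ennreal (\<beta> (A, B))"
    using bimeasure_kernel_rectangle[OF \<mu>.prob_space_axioms \<nu>.prob_space_axioms sets_\<nu> assms] by blast
  have \<kappa>_borel: "\<kappa> \<in> borel \<rightarrow>\<^sub>M prob_algebra borel"
    using \<kappa>(1) by (simp add: measurable_cong_sets[OF sets_\<mu> refl])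
  define K where "K x = distr (\<kappa> x) borel (Pair x)" for x
  define \<pi> where "\<pi> = \<mu> \<bind> K"
  note dis = is_disintegration_bind[OF \<mu>.prob_space_axioms sets_\<mu> \<kappa>_borel, folded K_def]
  have \<mu>_in: "\<mu> \<in> space (prob_algebra \<mu>)"
    by (simp add: space_prob_algebra \<mu>.prob_space_axioms)
  interpret prob_space \<pi>
    unfolding \<pi>_def by (rule prob_space_bind'[OF \<mu>_in dis(1)])
  have sets_\<pi>: "sets \<pi> = sets borel"
    unfolding \<pi>_def by (rule sets_bind'[OF \<mu>_in dis(1)])
  have sets_\<kappa>: "sets (\<kappa> x) = sets borel" for x
    using measurable_space[OF \<kappa>_borel, of x] by (simp add: space_prob_algebra)
  have rect: "measure \<pi> (A \<times> B) = \<beta> (A, B)" if "A \<in> sets borel" "B \<in> sets borel" for A B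
  proof -
    have "emeasure \<pi> (A \<times> B) = (\<integral>\<^sup>+x. (\<integral>\<^sup>+y. indicator (A \<times> B) (x, y) \<partial>\<kappa> x) \<partial>\<mu>)"
      using dis(2) Times_borel[OF that] unfolding is_disintegration_def \<pi>_def by blast
    also have "\<dots> = (\<integral>\<^sup>+x. emeasure (\<kappa> x) B * indicator A x \<partial>\<mu>)"
      using that sets_\<kappa>
      by (intro nn_integral_cong) (simp add: indicator_times nn_integral_cmult_indicator, simp add: mult.commute)
    finally have "emeasure \<pi> (A \<times> B) = ennreal (\<beta> (A, B))"
      using \<kappa>(2) that by simp
    then show ?thesis using nn by (simp add: measure_def)
  qed
  note fs = measurable_cong_sets[OF sets_\<pi> refl]
  have [measurable]: "fst \<in> \<pi> \<rightarrow>\<^sub>M borel" "snd \<in> \<pi> \<rightarrow>\<^sub>M borel"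
    by (auto simp: fs simp flip: borel_prod)
  have space_\<pi>: "space \<pi> = UNIV"
    using sets_eq_imp_space_eq[OF sets_\<pi>] by simp
  have "distr \<pi> borel fst = \<mu>"
  proof (rule measure_eqI)
    fix A assume "A \<in> sets (distr \<pi> borel fst)"
    then have A: "A \<in> sets borel" by simp
    have "fst -` A = A \<times> (UNIV :: real set)" by auto
    then show "emeasure (distr \<pi> borel fst) A = emeasure \<mu> A"
      using A rect[OF A, of UNIV] bimeasure_space2[OF assms, of A]
      by (simp add: emeasure_distr space_\<pi> emeasure_eq_measure \<mu>.emeasure_eq_measure)
  qed simp
  moreover have "distr \<pi> borel snd = \<nu>"
  proof (rule measure_eqI)
    fix B assume "B \<in> sets (distr \<pi> borel snd)"
    then have B: "B \<in> sets borel" by simp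
    have "snd -` B = (UNIV :: real set) \<times> B" by auto
    then show "emeasure (distr \<pi> borel snd) B = emeasure \<nu> B"
      using B rect[OF _ B, of UNIV] bimeasure_space1[OF assms, of B]
      by (simp add: emeasure_distr space_\<pi> emeasure_eq_measure \<nu>.emeasure_eq_measure)
  qed simp
  ultimately have "\<pi> \<in> couplings \<mu> \<nu>"
    using sets_\<pi> prob_space_axioms by (simp add: couplings_def borel_probs_def)
  moreover have "is_disintegration \<mu> \<pi> \<kappa>"
    unfolding \<pi>_def by (rule dis(2))
  ultimately show thesis
    using rect by (rule that)
qed

lemma bimeasure_of_coupling:
  assumes "\<pi> \<in> couplings \<mu> \<nu>"
  shows "(\<lambda>(A, B). measure \<pi> (A \<times> B)) \<in> bimeasures \<mu> \<nu>"
proof -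
  note \<pi> = couplingsD[OF assms]
  interpret prob_space \<pi> by fact
  have Un1: "measure \<pi> ((A \<union> A') \<times> B) = measure \<pi> (A \<times> B) + measure \<pi> (A' \<times> B)"
    if "A \<in> sets borel" "A' \<in> sets borel" "B \<in> sets borel" "A \<inter> A' = {}" for A A' B
    using that Times_borel \<pi>(2) by (subst finite_measure_Union[symmetric]) (auto simp: Sigma_Un_distrib1)
  have Un2: "measure \<pi> (A \<times> (B \<union> B')) = measure \<pi> (A \<times> B) + measure \<pi> (A \<times> B')"
    if "A \<in> sets borel" "B \<in> sets borel" "B' \<in> sets borel" "B \<inter> B' = {}" for A B B'
    using that Times_borel \<pi>(2) by (subst finite_measure_Union[symmetric]) (auto simp: Sigma_Un_distrib2)
  have "measure \<pi> (A \<times> UNIV) = measure \<mu> A" if "A \<in> sets borel" for A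
  proof -
    have "A \<times> UNIV = fst -` A \<inter> space \<pi>" using \<pi>(3) by auto
    then show ?thesis using measure_distr[OF \<pi>(6) that] \<pi>(4) by simp
  qed
  moreover have "measure \<pi> (UNIV \<times> B) = measure \<nu> B" if "B \<in> sets borel" for B
  proof -
    have "UNIV \<times> B = snd -` B \<inter> space \<pi>" using \<pi>(3) by auto
    then show ?thesis using measure_distr[OF \<pi>(7) that] \<pi>(5) by simp
  qed
  ultimately show ?thesis
    using Un1 Un2 by (simp add: bimeasures_def)
qed

lemma coupling_eqI:
  assumes "\<pi> \<in> couplings \<mu> \<nu>" "\<rho> \<in> couplings \<mu> \<nu>"
    and rect: "\<And>A B. A \<in> sets borel \<Longrightarrow> B \<in> sets borel \<Longrightarrow> measure \<pi> (A \<times> B) = measure \<rho> (A \<times> B)"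
  shows "\<pi> = \<rho>"
proof -
  note \<pi> = couplingsD[OF assms(1)] and \<rho> = couplingsD[OF assms(2)]
  interpret \<pi>: prob_space \<pi> by fact
  interpret \<rho>: prob_space \<rho> by fact
  let ?E = "{A \<times> B | A B. A \<in> sets (borel :: real measure) \<and> B \<in> sets (borel :: real measure)}"
  have "sets (borel :: (real \<times> real) measure) = sigma_sets UNIV ?E"
    by (subst borel_prod[symmetric]) (simp add: sets_pair_measure)
  then show ?thesis
    using \<pi> \<rho> rect
    by (intro measure_eqI_generator_eq[where E = ?E and \<Omega> = UNIV and A = "\<lambda>_. UNIV"]
        Int_stable_pair_measure_generator)
       (auto simp: \<pi>.emeasure_eq_measure \<rho>.emeasure_eq_measure intro!: exI[of _ UNIV])
qed

text \<open>
  The coupling rebuilt from the bimeasure of \<open>\<pi>\<close> is disintegrated by construction and agrees with \<open>\<pi>\<close>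
  on rectangles, hence is \<open>\<pi>\<close>.
\<close>

lemma is_disintegration_disintegration:
  assumes "\<pi> \<in> couplings \<mu> \<nu>"
  shows "is_disintegration \<mu> \<pi> (disintegration \<mu> \<pi>)"
proof -
  obtain \<rho> \<kappa> where "\<rho> \<in> couplings \<mu> \<nu>" "is_disintegration \<mu> \<rho> \<kappa>"
    "\<And>A B. A \<in> sets borel \<Longrightarrow> B \<in> sets borel \<Longrightarrow> measure \<rho> (A \<times> B) = measure \<pi> (A \<times> B)"
    using coupling_of_bimeasure[OF bimeasure_of_coupling[OF assms]] by auto
  moreover from this have "\<rho> = \<pi>"
    using assms by (intro coupling_eqI)
  ultimately show ?thesis
    unfolding disintegration_def by (metis someI)
qed

section \<open>The cost as a maximum of linear functionals\<close>

text \<open>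
  A measurable function with values \<open>\<plusminus>1\<close> is encoded by the set on which it is \<open>1\<close>.
\<close>

definition signed_displacement :: "real set \<Rightarrow> (real \<times> real) measure \<Rightarrow> real" where
  "signed_displacement A \<pi> = (\<integral>z. (if fst z \<in> A then 1 else - 1) * (fst z - snd z) \<partial>\<pi>)"

lemma integrable_signed_displacement:
  assumes "\<pi> \<in> couplings \<mu> \<nu>" and A: "A \<in> sets borel"
  shows "integrable \<pi> (\<lambda>z. (if fst z \<in> A then 1 else - 1) * (fst z - snd z))"
proof (rule Bochner_Integration.integrable_bound)
  note \<pi> = couplingsD[OF assms(1)]
  note [measurable] = \<pi>(6,7)
  show "integrable \<pi> (\<lambda>z. fst z - snd z)"
    using integrable_fst_coupling(1)[OF assms(1) first_moment_\<mu>]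
      integrable_snd_coupling(1)[OF assms(1) first_moment_\<nu>] by simp
  have [measurable]: "{z \<in> space \<pi>. fst z \<in> A} \<in> sets \<pi>"
    using A by measurable
  show "(\<lambda>z. (if fst z \<in> A then 1 else - 1) * (fst z - snd z)) \<in> borel_measurable \<pi>"
    by measurable
qed auto

text \<open>
  Integrating first along the kernel turns the functional into the integral of \<open>\<plusminus>(x - m x)\<close>, where \<open>m x\<close>
  is the barycentre of the kernel at \<open>x\<close>. This is at most the integral of \<open>\<bar>x - m x\<bar>\<close>, with equality if
  the sign is that of \<open>x - m x\<close>. Hence the cost is the maximum over all Borel sets; the supremum
  is stated here through its upper bounds.
\<close>

lemma martingale_cost_le_iff:
  assumes \<pi>: "\<pi> \<in> couplings \<mu> \<nu>"
  shows "martingale_cost \<mu> \<pi> \<le> c \<longleftrightarrow> (\<forall>A\<in>sets borel. signed_displacement A \<pi> \<le> c)"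
proof -
  define \<kappa> where "\<kappa> = disintegration \<mu> \<pi>"
  define m where "m x = (\<integral>y. y \<partial>\<kappa> x)" for x
  define K where "K x = distr (\<kappa> x) borel (Pair x)" for x
  have dis: "is_disintegration \<mu> \<pi> \<kappa>"
    unfolding \<kappa>_def by (rule is_disintegration_disintegration[OF \<pi>])
  then have \<kappa>: "\<kappa> \<in> borel \<rightarrow>\<^sub>M prob_algebra borel"
    by (simp add: is_disintegration_def)
  note K = is_disintegration_bind[OF \<mu>.prob_space_axioms sets_\<mu> \<kappa>, folded K_def]
  have \<pi>_eq: "\<pi> = \<mu> \<bind> K"
    using K(3) couplingsD(2)[OF \<pi>] dis by blast
  note fubini = integral_bind_integrable[OF measurable_prob_algebraD[OF K(1)] \<mu>.not_empty, folded \<pi>_eq]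
  have \<kappa>_prob: "prob_space (\<kappa> x)" and sets_\<kappa>: "sets (\<kappa> x) = sets borel" for x
    using measurable_space[OF \<kappa>, of x] by (auto simp: space_prob_algebra)
  have Pair_meas [measurable]: "Pair x \<in> \<kappa> x \<rightarrow>\<^sub>M (borel :: (real \<times> real) measure)" for x
    by (simp add: measurable_cong_sets[OF sets_\<kappa> refl])
  have snd_borel: "snd \<in> borel_measurable (borel :: (real \<times> real) measure)"
    by (simp flip: borel_prod)
  have [measurable]: "m \<in> borel_measurable borel"
    unfolding m_def
    using measurable_compose[OF measurable_prob_algebraD[OF \<kappa>] integral_measurable_subprob_algebra, of "\<lambda>y. y"]
    by simp
  have int_y: "AE x in \<mu>. integrable (\<kappa> x) (\<lambda>y. y)"
    using fubini(1)[OF integrable_snd_coupling(1)[OF \<pi> first_moment_\<nu>]]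
    by eventually_elim (simp add: K_def integrable_distr_eq[OF Pair_meas snd_borel])
  have inner: "AE x in \<mu>. (\<integral>z. (if fst z \<in> A then 1 else - 1) * (fst z - snd z) \<partial>K x)
      = (if x \<in> A then 1 else - 1) * (x - m x)" if A: "A \<in> sets borel" for A
    using int_y
  proof eventually_elim
    case (elim x)
    interpret prob_space "\<kappa> x" by (rule \<kappa>_prob)
    have "(\<lambda>z. (if fst z \<in> A then 1 else - 1) * (fst z - snd z))
        \<in> borel_measurable (borel \<Otimes>\<^sub>M (borel :: real measure) :: (real \<times> real) measure)"
      using A by measurable
    then have "(\<integral>z. (if fst z \<in> A then 1 else - 1) * (fst z - snd z) \<partial>K x)
        = (\<integral>y. (if x \<in> A then 1 else - 1) * (x - y) \<partial>\<kappa> x)"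
      unfolding K_def by (subst integral_distr[OF Pair_meas]) (auto simp: borel_prod)
    also have "\<dots> = (if x \<in> A then 1 else - 1) * (x - m x)"
      using elim by (simp add: m_def prob_space)
    finally show ?case .
  qed
  have displacement: "integrable \<mu> (\<lambda>x. (if x \<in> A then 1 else - 1) * (x - m x))"
      "signed_displacement A \<pi> = (\<integral>x. (if x \<in> A then 1 else - 1) * (x - m x) \<partial>\<mu>)"
    if A [measurable]: "A \<in> sets borel" for A
  proof -
    note I = integrable_signed_displacement[OF \<pi> A]
    have [measurable]: "(\<lambda>x. \<integral>z. (if fst z \<in> A then 1 else - 1) * (fst z - snd z) \<partial>K x) \<in> borel_measurable \<mu>"
      using fubini(2)[OF I] by auto
    show "integrable \<mu> (\<lambda>x. (if x \<in> A then 1 else - 1) * (x - m x))"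
      using fubini(2)[OF I] by (subst (asm) integrable_cong_AE[OF _ _ inner[OF A]]) auto
    show "signed_displacement A \<pi> = (\<integral>x. (if x \<in> A then 1 else - 1) * (x - m x) \<partial>\<mu>)"
      unfolding signed_displacement_def fubini(3)[OF I] using inner[OF A] by (intro integral_cong_AE) auto
  qed
  have cost: "martingale_cost \<mu> \<pi> = (\<integral>x. \<bar>x - m x\<bar> \<partial>\<mu>)"
    by (simp add: martingale_cost_def m_def \<kappa>_def)
  define P where "P = {x. m x \<le> x}"
  have P: "P \<in> sets borel"
    unfolding P_def by measurable
  have abs_eq: "(if x \<in> P then 1 else - 1) * (x - m x) = \<bar>x - m x\<bar>" for x
    by (auto simp: P_def)
  have "signed_displacement P \<pi> = martingale_cost \<mu> \<pi>"
    using displacement(2)[OF P] by (simp only: abs_eq cost)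
  moreover have "signed_displacement A \<pi> \<le> martingale_cost \<mu> \<pi>" if A: "A \<in> sets borel" for A
    unfolding displacement(2)[OF A] cost
    using displacement(1)[OF A] displacement(1)[OF P, unfolded abs_eq] by (intro integral_mono) auto
  ultimately show ?thesis
    using P by (auto intro: order_trans)
qed

end

section \<open>Convexity\<close>

text \<open>
  A convex combination is a mixture along a kernel on two points, chosen with a biased coin. This makes
  \<open>integral_bind_integrable\<close> available for it.
\<close>

lemma mixture_eq_bind:
  fixes \<pi> \<rho> :: "'a::topological_space measure"
  assumes "\<pi> \<in> borel_probs" "\<rho> \<in> borel_probs" and t: "t \<in> {0..1}"
  defines "K \<equiv> \<lambda>b. if b then \<rho> else \<pi>"
  shows "K \<in> measure_pmf (bernoulli_pmf t) \<rightarrow>\<^sub>M prob_algebra borel"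
    and "mixture t \<pi> \<rho> = measure_pmf (bernoulli_pmf t) \<bind> K"
proof -
  show K: "K \<in> measure_pmf (bernoulli_pmf t) \<rightarrow>\<^sub>M prob_algebra borel"
    using assms by (auto simp: measurable_def K_def space_prob_algebra borel_probs_def)
  note K' = measurable_prob_algebraD[OF K]
  show "mixture t \<pi> \<rho> = measure_pmf (bernoulli_pmf t) \<bind> K"
  proof (rule measure_eqI)
    show "sets (mixture t \<pi> \<rho>) = sets (measure_pmf (bernoulli_pmf t) \<bind> K)"
      using sets_kernel[OF K'] by (subst sets_bind[where N = borel]) auto
    fix C assume "C \<in> sets (mixture t \<pi> \<rho>)"
    then show "emeasure (mixture t \<pi> \<rho>) C = emeasure (measure_pmf (bernoulli_pmf t) \<bind> K) C"
      using assms K'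
      by (subst emeasure_bind[where N = borel])
         (auto simp: emeasure_mixture borel_probs_def K_def mult.commute add.commute)
  qed
qed

context real_marginals
begin

lemma mixture_in_couplings:
  assumes "\<pi> \<in> couplings \<mu> \<nu>" "\<rho> \<in> couplings \<mu> \<nu>" and t: "t \<in> {0..1}"
  shows "mixture t \<pi> \<rho> \<in> couplings \<mu> \<nu>"
proof -
  note \<pi> = couplingsD[OF assms(1)] and \<rho> = couplingsD[OF assms(2)]
  let ?m = "mixture t \<pi> \<rho>"
  have probs: "\<pi> \<in> borel_probs" "\<rho> \<in> borel_probs"
    using assms by (auto simp: couplings_def)
  note K = mixture_eq_bind[OF probs t]
  have "prob_space ?m"
    unfolding K(2)
    by (rule prob_space_bind'[OF _ K(1)]) (simp add: space_prob_algebra measure_pmf.prob_space_axioms)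
  then have "?m \<in> borel_probs"
    by (simp add: borel_probs_def)
  have space_m: "space ?m = UNIV"
    using sets_eq_imp_space_eq[OF sets_mixture[of t \<pi> \<rho>]] by simp
  have marginal: "distr ?m borel p = \<theta>"
    if p: "p \<in> (borel :: (real \<times> real) measure) \<rightarrow>\<^sub>M (borel :: real measure)"
      and "distr \<pi> borel p = \<theta>" "distr \<rho> borel p = \<theta>" for p \<theta>
  proof (rule measure_eqI)
    show "sets (distr ?m borel p) = sets \<theta>" using that by auto
    fix A assume "A \<in> sets (distr ?m borel p)"
    then have A: "A \<in> sets borel" by simp
    have [measurable]: "p \<in> ?m \<rightarrow>\<^sub>M borel" "p \<in> \<pi> \<rightarrow>\<^sub>M borel" "p \<in> \<rho> \<rightarrow>\<^sub>M borel"
      using p \<pi>(2) \<rho>(2) by (auto cong: measurable_cong_sets)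
    have "p -` A \<in> sets borel"
      using measurable_sets[OF p A] by simp
    then have "emeasure (distr ?m borel p) A
        = ennreal (1 - t) * emeasure (distr \<pi> borel p) A + ennreal t * emeasure (distr \<rho> borel p) A"
      using A \<pi> \<rho> space_m by (simp add: emeasure_distr emeasure_mixture)
    also have "\<dots> = (ennreal (1 - t) + ennreal t) * emeasure \<theta> A"
      using that by (simp add: distrib_right)
    also have "ennreal (1 - t) + ennreal t = 1"
      using t by (simp flip: ennreal_plus)
    finally show "emeasure (distr ?m borel p) A = emeasure \<theta> A" by simp
  qed
  have "fst \<in> (borel :: (real \<times> real) measure) \<rightarrow>\<^sub>M borel" "snd \<in> (borel :: (real \<times> real) measure) \<rightarrow>\<^sub>M borel"
    by (simp_all flip: borel_prod)
  with \<open>?m \<in> borel_probs\<close> \<pi> \<rho> show ?thesis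
    by (simp add: couplings_def marginal)
qed

lemma signed_displacement_mixture:
  assumes "\<pi> \<in> couplings \<mu> \<nu>" "\<rho> \<in> couplings \<mu> \<nu>" and t: "t \<in> {0..1}" and A: "A \<in> sets borel"
  shows "signed_displacement A (mixture t \<pi> \<rho>)
           = (1 - t) * signed_displacement A \<pi> + t * signed_displacement A \<rho>"
proof -
  have probs: "\<pi> \<in> borel_probs" "\<rho> \<in> borel_probs"
    using assms by (auto simp: couplings_def)
  note K = mixture_eq_bind[OF probs t]
  show ?thesis
    unfolding signed_displacement_def K(2)
    using integrable_signed_displacement[OF mixture_in_couplings[OF assms(1-3)] A] t
    by (subst integral_bind_integrable(3)[OF measurable_prob_algebraD[OF K(1)]])
       (auto simp: K(2) mult.commute)
qed

lemma convex_cost_sublevel: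
  "convex_measures {\<pi> \<in> couplings \<mu> \<nu>. martingale_cost \<mu> \<pi> \<le> c}"
  unfolding convex_measures_def
proof (intro ballI)
  fix \<pi> \<rho> and t :: real
  assume \<pi>: "\<pi> \<in> {\<pi> \<in> couplings \<mu> \<nu>. martingale_cost \<mu> \<pi> \<le> c}"
    and \<rho>: "\<rho> \<in> {\<pi> \<in> couplings \<mu> \<nu>. martingale_cost \<mu> \<pi> \<le> c}" and t: "t \<in> {0..1}"
  then have mix: "mixture t \<pi> \<rho> \<in> couplings \<mu> \<nu>"
    by (intro mixture_in_couplings) auto
  have "signed_displacement A (mixture t \<pi> \<rho>) \<le> c" if A: "A \<in> sets borel" for A
  proof -
    have "signed_displacement A \<pi> \<le> c" "signed_displacement A \<rho> \<le> c"
      using \<pi> \<rho> A by (auto simp: martingale_cost_le_iff)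
    then have "(1 - t) * signed_displacement A \<pi> + t * signed_displacement A \<rho> \<le> c"
      using t by (intro convex_bound_le) auto
    then show ?thesis
      using \<pi> \<rho> t A by (simp add: signed_displacement_mixture)
  qed
  with mix show "mixture t \<pi> \<rho> \<in> {\<pi> \<in> couplings \<mu> \<nu>. martingale_cost \<mu> \<pi> \<le> c}"
    by (simp add: martingale_cost_le_iff)
qed

end

section \<open>Continuity and compactness\<close>

lemma continuous_on_uniform_approximation:
  fixes u :: "'a::topological_space \<Rightarrow> real"
  assumes "\<And>e. 0 < e \<Longrightarrow> \<exists>v. continuous_on S v \<and> (\<forall>x\<in>S. \<bar>u x - v x\<bar> \<le> e)"
  shows "continuous_on S u"
proof -
  have "\<exists>v. \<forall>n. continuous_on S (v n) \<and> (\<forall>x\<in>S. \<bar>u x - v n x\<bar> \<le> inverse (real (Suc n)))"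
    by (intro choice allI assms) simp
  then obtain v where v: "\<And>n. continuous_on S (v n)"
      "\<And>n x. x \<in> S \<Longrightarrow> \<bar>u x - v n x\<bar> \<le> inverse (real (Suc n))"
    by blast
  have "uniform_limit S v u sequentially"
  proof (rule uniform_limitI)
    fix e :: real assume "0 < e"
    then have "\<forall>\<^sub>F n in sequentially. inverse (real (Suc n)) < e"
      using order_tendstoD(2)[OF LIMSEQ_inverse_real_of_nat] by blast
    then show "\<forall>\<^sub>F n in sequentially. \<forall>x\<in>S. dist (v n x) (u x) < e"
    proof eventually_elim
      case (elim n)
      show ?case
      proof
        fix x assume "x \<in> S"
        from le_less_trans[OF v(2)[OF this, of n] elim] show "dist (v n x) (u x) < e"
          by (simp add: dist_real_def abs_minus_commute)
      qed
    qed
  qed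
  then show ?thesis
    using v(1) by (intro uniform_limit_theorem[of _ v]) auto
qed

context real_marginals
begin

text \<open>
  Measures agreeing with \<open>\<beta>\<close> on Borel rectangles are equal, so for a bimeasure \<open>\<beta>\<close> the choice is
  unique.
\<close>

definition coupling_of :: "(real set \<times> real set \<Rightarrow> real) \<Rightarrow> (real \<times> real) measure" where
  "coupling_of \<beta> = (SOME \<pi>. \<pi> \<in> couplings \<mu> \<nu> \<and>
     (\<forall>A\<in>sets borel. \<forall>B\<in>sets borel. measure \<pi> (A \<times> B) = \<beta> (A, B)))"

lemma coupling_of:
  assumes "\<beta> \<in> bimeasures \<mu> \<nu>"
  shows "coupling_of \<beta> \<in> couplings \<mu> \<nu>"
    and "A \<in> sets borel \<Longrightarrow> B \<in> sets borel \<Longrightarrow> measure (coupling_of \<beta>) (A \<times> B) = \<beta> (A, B)"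
proof -
  have "\<exists>\<pi>. \<pi> \<in> couplings \<mu> \<nu> \<and>
     (\<forall>A\<in>sets borel. \<forall>B\<in>sets borel. measure \<pi> (A \<times> B) = \<beta> (A, B))"
    using coupling_of_bimeasure[OF assms] by metis
  from someI_ex[OF this, folded coupling_of_def]
  show "coupling_of \<beta> \<in> couplings \<mu> \<nu>"
    and "A \<in> sets borel \<Longrightarrow> B \<in> sets borel \<Longrightarrow> measure (coupling_of \<beta>) (A \<times> B) = \<beta> (A, B)"
    by auto
qed

lemma coupling_of_surj:
  assumes "\<pi> \<in> couplings \<mu> \<nu>"
  obtains \<beta> where "\<beta> \<in> bimeasures \<mu> \<nu>" "coupling_of \<beta> = \<pi>"
proof -
  let ?\<beta> = "\<lambda>(A, B). measure \<pi> (A \<times> B)"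
  have \<beta>: "?\<beta> \<in> bimeasures \<mu> \<nu>"
    by (rule bimeasure_of_coupling[OF assms])
  then have "coupling_of ?\<beta> = \<pi>"
    using coupling_of[OF \<beta>] by (intro coupling_eqI assms) auto
  with \<beta> show thesis by (rule that)
qed

text \<open>
  For indicators \<open>g\<close> the functional is a multiple of a coordinate of \<open>\<beta>\<close>. The general case follows by
  approximation in \<open>L\<^sup>1\<close> of \<open>\<nu>\<close>: the error is at most the distance of the functions in that space, and
  this bound is the same for all couplings.
\<close>

lemma continuous_on_integral_indicator_times:
  fixes g :: "real \<Rightarrow> real"
  assumes A: "A \<in> sets borel" and g: "integrable \<nu> g"
  shows "continuous_on (bimeasures \<mu> \<nu>) (\<lambda>\<beta>. \<integral>z. indicator A (fst z) * g (snd z) \<partial>coupling_of \<beta>)"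
proof -
  have int: "integrable (coupling_of \<beta>) (\<lambda>z. indicator A (fst z) * h (snd z))"
    if "\<beta> \<in> bimeasures \<mu> \<nu>" "integrable \<nu> h" for \<beta> and h :: "real \<Rightarrow> real"
  proof -
    note c = coupling_of(1)[OF that(1)]
    note [measurable] = couplingsD(6,7)[OF c] A
    have "integrable (coupling_of \<beta>) (\<lambda>z. h (snd z))"
      by (rule integrable_snd_coupling[OF c that(2)])
    then show ?thesis
    proof (rule Bochner_Integration.integrable_bound)
      have [measurable]: "h \<in> borel_measurable borel"
        using borel_measurable_integrable[OF that(2)] by measurable
      show "(\<lambda>z. indicator A (fst z) * h (snd z)) \<in> borel_measurable (coupling_of \<beta>)"
        by measurable
    qed (auto simp: indicator_def)
  qed
  show ?thesis
    using g
  proof (induction rule: integrable_induct)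
    case (base B c)
    have "(\<integral>z. indicator A (fst z) * (indicator B (snd z) *\<^sub>R c) \<partial>coupling_of \<beta>) = c * \<beta> (A, B)"
      if \<beta>: "\<beta> \<in> bimeasures \<mu> \<nu>" for \<beta>
    proof -
      note \<pi> = couplingsD[OF coupling_of(1)[OF \<beta>]]
      have "(\<integral>z. indicator A (fst z) * (indicator B (snd z) *\<^sub>R c) \<partial>coupling_of \<beta>)
          = (\<integral>z. c * indicator (A \<times> B) z \<partial>coupling_of \<beta>)"
        by (intro Bochner_Integration.integral_cong) (auto simp: indicator_def)
      also have "\<dots> = c * measure (coupling_of \<beta>) (A \<times> B)"
        using \<pi>(3) by simp
      finally show ?thesis
        using coupling_of(2)[OF \<beta> A] base by simp
    qed
    then show ?case
      by (subst continuous_on_cong[OF refl])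
         (auto intro!: continuous_on_mult continuous_on_const
            continuous_on_subset[OF continuous_on_product_coordinates])
  next
    case (add f h)
    have "(\<integral>z. indicator A (fst z) * (f (snd z) + h (snd z)) \<partial>coupling_of \<beta>)
        = (\<integral>z. indicator A (fst z) * f (snd z) \<partial>coupling_of \<beta>)
          + (\<integral>z. indicator A (fst z) * h (snd z) \<partial>coupling_of \<beta>)"
      if "\<beta> \<in> bimeasures \<mu> \<nu>" for \<beta>
      using int[OF that add(1)] int[OF that add(2)] by (simp add: distrib_left)
    then show ?case
      using continuous_on_add[OF add(3,4)] by (subst continuous_on_cong[OF refl]) auto
  next
    case (lim f s)
    have "(\<lambda>i. \<integral>y. \<bar>f y - s i y\<bar> \<partial>\<nu>) \<longlonglongrightarrow> (\<integral>y. 0 \<partial>\<nu>)"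
    proof (rule integral_dominated_convergence[where w = "\<lambda>y. 3 * \<bar>f y\<bar>"])
      have "(\<lambda>i. \<bar>f y - s i y\<bar>) \<longlonglongrightarrow> \<bar>f y - f y\<bar>" for y
        using lim(2)[of y] by (intro tendsto_intros) simp
      then show "AE y in \<nu>. (\<lambda>i. \<bar>f y - s i y\<bar>) \<longlonglongrightarrow> 0"
        by simp
      have "\<bar>f y - s i y\<bar> \<le> 3 * \<bar>f y\<bar>" for i y
        using lim(3)[of y i] by simp
      then show "AE y in \<nu>. norm \<bar>f y - s i y\<bar> \<le> 3 * \<bar>f y\<bar>" for i
        by simp
    qed (use lim in auto)
    then have L1: "(\<lambda>i. \<integral>y. \<bar>f y - s i y\<bar> \<partial>\<nu>) \<longlonglongrightarrow> 0"
      by simp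
    show ?case
    proof (rule continuous_on_uniform_approximation)
      fix e :: real assume "0 < e"
      then obtain i where i: "(\<integral>y. \<bar>f y - s i y\<bar> \<partial>\<nu>) < e"
        using order_tendstoD(2)[OF L1] eventually_happens'[OF sequentially_bot] by blast
      have "\<bar>(\<integral>z. indicator A (fst z) * f (snd z) \<partial>coupling_of \<beta>)
          - (\<integral>z. indicator A (fst z) * s i (snd z) \<partial>coupling_of \<beta>)\<bar> \<le> e"
        if \<beta>: "\<beta> \<in> bimeasures \<mu> \<nu>" for \<beta>
      proof -
        note c = coupling_of(1)[OF \<beta>]
        have fs: "integrable \<nu> (\<lambda>y. \<bar>f y - s i y\<bar>)"
          using lim by auto
        note I = int[OF \<beta> lim(4)] int[OF \<beta> lim(1)[of i]]
        have "\<bar>\<integral>z. indicator A (fst z) * f (snd z) - indicator A (fst z) * s i (snd z) \<partial>coupling_of \<beta>\<bar>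
            \<le> (\<integral>z. \<bar>f (snd z) - s i (snd z)\<bar> \<partial>coupling_of \<beta>)"
          using I integrable_snd_coupling(1)[OF c fs]
          by (intro integral_abs_bound[THEN order_trans] integral_mono) (auto simp: indicator_def)
        also have "\<dots> = (\<integral>y. \<bar>f y - s i y\<bar> \<partial>\<nu>)"
          by (rule integrable_snd_coupling(2)[OF c fs])
        finally show ?thesis
          using i I by simp
      qed
      then show "\<exists>v. continuous_on (bimeasures \<mu> \<nu>) v \<and> (\<forall>\<beta>\<in>bimeasures \<mu> \<nu>.
          \<bar>(\<integral>z. indicator A (fst z) * f (snd z) \<partial>coupling_of \<beta>) - v \<beta>\<bar> \<le> e)"
        using lim(5)[of i] by blast
    qed
  qed
qed

text \<open>
  The terms of the functional that depend on one variable only are determined by the marginals.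
\<close>

lemma continuous_on_signed_displacement:
  assumes A: "A \<in> sets borel"
  shows "continuous_on (bimeasures \<mu> \<nu>) (\<lambda>\<beta>. signed_displacement A (coupling_of \<beta>))"
proof -
  have eq: "signed_displacement A (coupling_of \<beta>) =
      (\<integral>x. (if x \<in> A then 1 else - 1) * x \<partial>\<mu>) + (\<integral>y. y \<partial>\<nu>)
        - 2 * (\<integral>z. indicator A (fst z) * snd z \<partial>coupling_of \<beta>)"
    if \<beta>: "\<beta> \<in> bimeasures \<mu> \<nu>" for \<beta>
  proof -
    note c = coupling_of(1)[OF \<beta>]
    note [measurable] = couplingsD(6,7)[OF c] A
    have i1: "integrable \<mu> (\<lambda>x. (if x \<in> A then 1 else - 1) * x)"
      by (rule Bochner_Integration.integrable_bound[OF first_moment_\<mu>]) auto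
    have i2: "integrable (coupling_of \<beta>) (\<lambda>z. snd z)"
      by (rule integrable_snd_coupling[OF c first_moment_\<nu>])
    have i3: "integrable (coupling_of \<beta>) (\<lambda>z. indicator A (fst z) * snd z)"
      by (rule Bochner_Integration.integrable_bound[OF i2]) (auto simp: indicator_def)
    have "signed_displacement A (coupling_of \<beta>) =
        (\<integral>z. (if fst z \<in> A then 1 else - 1) * fst z + snd z - 2 * (indicator A (fst z) * snd z) \<partial>coupling_of \<beta>)"
      unfolding signed_displacement_def
      by (intro Bochner_Integration.integral_cong) (auto simp: indicator_def algebra_simps)
    also have "\<dots> = (\<integral>z. (if fst z \<in> A then 1 else - 1) * fst z \<partial>coupling_of \<beta>)
        + (\<integral>z. snd z \<partial>coupling_of \<beta>) - 2 * (\<integral>z. indicator A (fst z) * snd z \<partial>coupling_of \<beta>)"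
      using integrable_fst_coupling(1)[OF c i1] i2 i3 by simp
    finally show ?thesis
      using integrable_fst_coupling(2)[OF c i1] integrable_snd_coupling(2)[OF c first_moment_\<nu>] by simp
  qed
  show ?thesis
    using continuous_on_integral_indicator_times[OF A first_moment_\<nu>]
    by (subst continuous_on_cong[OF refl eq]) (auto intro!: continuous_intros)
qed

lemma tight_marginals:
  assumes "0 < e"
  obtains n :: nat where "measure \<mu> (- {- real n..<real n}) < e" "measure \<nu> (- {- real n..<real n}) < e"
proof -
  let ?B = "\<lambda>n. - {- real n..<real n}"
  have dec: "decseq ?B"
    by (auto simp: decseq_def)
  have "(\<Inter>n. ?B n) = {}"
  proof -
    have "\<exists>n. x \<in> {- real n..<real n}" for x :: real
    proof -
      obtain n where "\<bar>x\<bar> < real n"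
        using reals_Archimedean2 by blast
      then show ?thesis
        by (intro exI[of _ n]) auto
    qed
    then show ?thesis by blast
  qed
  then have "(\<lambda>n. measure \<mu> (?B n)) \<longlonglongrightarrow> 0" "(\<lambda>n. measure \<nu> (?B n)) \<longlonglongrightarrow> 0"
    using \<mu>.finite_Lim_measure_decseq[OF _ dec] \<nu>.finite_Lim_measure_decseq[OF _ dec]
    by (simp_all add: image_subset_iff)
  then have "\<forall>\<^sub>F n in sequentially. measure \<mu> (?B n) < e \<and> measure \<nu> (?B n) < e"
    using assms by (intro eventually_conj order_tendstoD)
  then show thesis
    using eventually_happens'[OF sequentially_bot] that by blast
qed

text \<open>
  The approximant is the integral of a function that is constant on the cells of a grid inside the
  square \<open>[-L, L)\<^sup>2\<close>, and zero outside it. Its error is at most \<open>e / 2\<close> in the square, by uniform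
  continuity. The two strips that cover the complement have masses that only depend on the marginals.
\<close>

lemma continuous_on_integral_coupling_of:
  fixes f :: "real \<times> real \<Rightarrow> real"
  assumes cont: "continuous_on UNIV f" and "bounded (range f)"
  shows "continuous_on (bimeasures \<mu> \<nu>) (\<lambda>\<beta>. \<integral>z. f z \<partial>coupling_of \<beta>)"
proof (rule continuous_on_uniform_approximation)
  fix e :: real assume "0 < e"
  obtain C where C: "0 < C" "\<And>z. \<bar>f z\<bar> \<le> C"
    using \<open>bounded (range f)\<close> by (auto simp: bounded_pos)
  \<comment> \<open>Each of the two strips may contribute \<open>e / 4\<close>, as the error outside the square is at most \<open>C\<close>.\<close>
  obtain L :: nat where L: "measure \<mu> (- {- real L..<real L}) < e / (4 * C)"
      "measure \<nu> (- {- real L..<real L}) < e / (4 * C)"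
    using tight_marginals[of "e / (4 * C)"] \<open>0 < e\<close> C by auto
  let ?R = "{- real L..real L}"
  have "uniformly_continuous_on (?R \<times> ?R) f"
    by (intro compact_uniformly_continuous compact_Times continuous_on_subset[OF cont]) auto
  then obtain d where d: "0 < d" "\<And>z w. z \<in> ?R \<times> ?R \<Longrightarrow> w \<in> ?R \<times> ?R \<Longrightarrow> dist z w < d \<Longrightarrow> \<bar>f z - f w\<bar> < e / 2"
    using \<open>0 < e\<close> unfolding uniformly_continuous_on_def dist_real_def by (metis half_gt_zero)
  \<comment> \<open>Rounding down to the grid of width \<open>1 / n\<close> moves a point by less than \<open>1 / n\<close> in each coordinate.\<close>
  obtain n :: nat where n: "0 < n" "2 / real n < d"
  proof -
    obtain n :: nat where "2 / d < real n"
      using reals_Archimedean2 by blast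
    moreover from this have "0 < real n"
      using d(1) by (meson divide_pos_pos less_trans zero_less_numeral)
    ultimately show thesis
      using d(1) by (intro that[of n]) (auto simp: field_simps)
  qed
  \<comment> \<open>Since \<open>L\<close> is an integer, the cells indexed by \<open>I\<close> fill \<open>[-L, L)\<close> exactly.\<close>
  define I where "I = {- int (n * L)..<int (n * L)}"
  define cell where "cell i = {x. \<lfloor>real n * x\<rfloor> = i}" for i
  define node where "node i = real_of_int i / real n" for i
  define v where "v \<beta> = (\<Sum>i\<in>I. \<Sum>j\<in>I. f (node i, node j) * \<beta> (cell i, cell j))" for \<beta> :: "real set \<times> real set \<Rightarrow> real"
  define f_grid where "f_grid z = (\<Sum>i\<in>I. \<Sum>j\<in>I. f (node i, node j) * indicator (cell i \<times> cell j) z)" for z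
  have cell: "cell i \<in> sets borel" for i
    unfolding cell_def by measurable
  have in_I: "\<lfloor>real n * x\<rfloor> \<in> I \<longleftrightarrow> x \<in> {- real L..<real L}" for x
  proof -
    have "- int (n * L) \<le> \<lfloor>real n * x\<rfloor> \<longleftrightarrow> real n * (- real L) \<le> real n * x"
      by (subst le_floor_iff) simp
    then have "- int (n * L) \<le> \<lfloor>real n * x\<rfloor> \<longleftrightarrow> - real L \<le> x"
      using n(1) by (simp only: mult_le_cancel_left_pos of_nat_0_less_iff)
    moreover have "\<lfloor>real n * x\<rfloor> < int (n * L) \<longleftrightarrow> real n * x < real n * real L"
      by (subst floor_less_iff) simp
    then have "\<lfloor>real n * x\<rfloor> < int (n * L) \<longleftrightarrow> x < real L"
      using n(1) by (simp only: mult_less_cancel_left_pos of_nat_0_less_iff)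
    ultimately show ?thesis
      by (simp only: I_def atLeastLessThan_iff)
  qed
  have f_grid: "f_grid (x, y) = (if x \<in> {- real L..<real L} \<and> y \<in> {- real L..<real L}
      then f (node \<lfloor>real n * x\<rfloor>, node \<lfloor>real n * y\<rfloor>) else 0)" for x y
  proof -
    have "f_grid (x, y) = (\<Sum>i\<in>I. if \<lfloor>real n * x\<rfloor> = i then
        (\<Sum>j\<in>I. if \<lfloor>real n * y\<rfloor> = j then f (node i, node j) else 0) else 0)"
      unfolding f_grid_def by (intro sum.cong refl) (auto simp: cell_def indicator_def intro!: sum.cong)
    also have "\<dots> = (if \<lfloor>real n * x\<rfloor> \<in> I then if \<lfloor>real n * y\<rfloor> \<in> I
        then f (node \<lfloor>real n * x\<rfloor>, node \<lfloor>real n * y\<rfloor>) else 0 else 0)"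
      by (simp add: sum.delta I_def)
    finally show ?thesis by (simp add: in_I)
  qed
  have node_near: "node \<lfloor>real n * x\<rfloor> \<in> ?R" "\<bar>x - node \<lfloor>real n * x\<rfloor>\<bar> < 1 / real n"
    if "x \<in> {- real L..<real L}" for x
  proof -
    have "node \<lfloor>real n * x\<rfloor> \<le> x" "x < node \<lfloor>real n * x\<rfloor> + 1 / real n"
      using n(1) by (auto simp: node_def field_simps) linarith+
    moreover have "- real L \<le> node \<lfloor>real n * x\<rfloor>"
    proof -
      have "- int (n * L) \<le> \<lfloor>real n * x\<rfloor>"
        using in_I[of x] that by (simp add: I_def)
      then have "real_of_int (- int (n * L)) \<le> real_of_int \<lfloor>real n * x\<rfloor>"
        by (simp only: of_int_le_iff)
      then show ?thesis
        using n(1) by (simp add: node_def field_simps)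
    qed
    ultimately show "node \<lfloor>real n * x\<rfloor> \<in> ?R" "\<bar>x - node \<lfloor>real n * x\<rfloor>\<bar> < 1 / real n"
      using that by auto
  qed
  have approx: "\<bar>f z - f_grid z\<bar> \<le> e / 2 + C * indicator (- {- real L..<real L}) (fst z)
      + C * indicator (- {- real L..<real L}) (snd z)" for z
  proof (cases z)
    case (Pair x y)
    show ?thesis
    proof (cases "x \<in> {- real L..<real L} \<and> y \<in> {- real L..<real L}")
      case True
      let ?w = "(node \<lfloor>real n * x\<rfloor>, node \<lfloor>real n * y\<rfloor>)"
      have "dist z ?w \<le> \<bar>x - node \<lfloor>real n * x\<rfloor>\<bar> + \<bar>y - node \<lfloor>real n * y\<rfloor>\<bar>"
        unfolding Pair dist_Pair_Pair dist_real_def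
        using sqrt_sum_squares_le_sum_abs[of "x - node \<lfloor>real n * x\<rfloor>" "y - node \<lfloor>real n * y\<rfloor>"] by simp
      also have "\<dots> < d"
        using node_near(2)[of x] node_near(2)[of y] True n(2) by simp
      finally have "\<bar>f z - f ?w\<bar> < e / 2"
        using True node_near(1) by (intro d(2)) (auto simp: Pair)
      then show ?thesis
        using True by (simp add: Pair f_grid)
    next
      case False
      then show ?thesis
        using C(1) C(2)[of z] \<open>0 < e\<close> by (auto simp: Pair f_grid indicator_def)
    qed
  qed
  have "\<bar>(\<integral>z. f z \<partial>coupling_of \<beta>) - v \<beta>\<bar> \<le> e" if \<beta>: "\<beta> \<in> bimeasures \<mu> \<nu>" for \<beta>
  proof -
    let ?\<pi> = "coupling_of \<beta>"
    let ?B = "- {- real L..<real L}"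
    note c = coupling_of(1)[OF \<beta>]
    note \<pi> = couplingsD[OF c]
    interpret \<pi>: prob_space ?\<pi> by (rule \<pi>(1))
    note [measurable] = \<pi>(6,7)
    have rect: "cell i \<times> cell j \<in> sets ?\<pi>" for i j
      using Times_borel[OF cell cell] \<pi>(2) by simp
    have "f \<in> borel_measurable ?\<pi>"
      using borel_measurable_continuous_onI[OF cont] by (simp add: measurable_cong_sets[OF \<pi>(2) refl])
    then have int_f: "integrable ?\<pi> f"
      using C by (intro \<pi>.integrable_const_bound[where B = C]) auto
    have int_cell: "integrable ?\<pi> (\<lambda>z. a * indicator (cell i \<times> cell j) z)" for a :: real and i j
      using rect by (intro integrable_mult_right integrable_real_indicator) (auto simp: \<pi>.emeasure_eq_measure)
    have int_grid: "integrable ?\<pi> f_grid"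
      unfolding f_grid_def by (intro Bochner_Integration.integrable_sum int_cell)
    have "integral\<^sup>L ?\<pi> f_grid = v \<beta>"
      unfolding f_grid_def v_def
      using int_cell rect coupling_of(2)[OF \<beta> cell cell] \<pi>(3)
      by (subst Bochner_Integration.integral_sum, (intro Bochner_Integration.integrable_sum int_cell))
         (auto intro!: sum.cong simp: Bochner_Integration.integral_sum)
    have ind: "integrable \<mu> (indicat_real ?B)" "integrable \<nu> (indicat_real ?B)"
      by (auto simp: \<mu>.emeasure_eq_measure \<nu>.emeasure_eq_measure)
    note i1 = integrable_fst_coupling[OF c ind(1)] and i2 = integrable_snd_coupling[OF c ind(2)]
    have "\<bar>\<integral>z. f z - f_grid z \<partial>?\<pi>\<bar> \<le> (\<integral>z. e / 2 + C * indicator ?B (fst z) + C * indicator ?B (snd z) \<partial>?\<pi>)"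
      using int_f int_grid i1(1) i2(1) approx
      by (intro integral_abs_bound[THEN order_trans] integral_mono) auto
    also have "\<dots> = e / 2 + C * measure \<mu> ?B + C * measure \<nu> ?B"
      using i1 i2 \<pi>.prob_space by simp
    also have "\<dots> \<le> e / 2 + C * (e / (4 * C)) + C * (e / (4 * C))"
      using L C(1) by (intro add_mono mult_left_mono) auto
    also have "\<dots> = e"
      using C(1) by (simp add: field_simps)
    finally show ?thesis
      using int_f int_grid \<open>integral\<^sup>L ?\<pi> f_grid = v \<beta>\<close> by simp
  qed
  moreover have "continuous_on (bimeasures \<mu> \<nu>) v"
    unfolding v_def
    by (intro continuous_on_sum continuous_on_mult continuous_on_const
        continuous_on_subset[OF continuous_on_product_coordinates]) auto
  ultimately show "\<exists>v. continuous_on (bimeasures \<mu> \<nu>) v \<and>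
      (\<forall>\<beta>\<in>bimeasures \<mu> \<nu>. \<bar>(\<integral>z. f z \<partial>coupling_of \<beta>) - v \<beta>\<bar> \<le> e)"
    by blast
qed

lemma continuous_map_coupling_of:
  "continuous_map (top_of_set (bimeasures \<mu> \<nu>)) weak_topology coupling_of"
  unfolding weak_topology_def
proof (rule continuous_on_generated_topo)
  have probs: "coupling_of \<beta> \<in> borel_probs" if "\<beta> \<in> bimeasures \<mu> \<nu>" for \<beta>
    using coupling_of(1)[OF that] by (simp add: couplings_def)
  then show "coupling_of ` topspace (top_of_set (bimeasures \<mu> \<nu>)) \<subseteq>
      \<Union> {{\<pi> \<in> borel_probs. (\<integral>z. f z \<partial>\<pi>) \<in> U} | (f :: real \<times> real \<Rightarrow> real) U.
        continuous_on UNIV f \<and> bounded (range f) \<and> open U}"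
    using topspace_weak_topology[where 'a = "real \<times> real"]
    unfolding weak_topology_def topology_generated_by_topspace by auto
  fix W :: "(real \<times> real) measure set"
  assume "W \<in> {{\<pi> \<in> borel_probs. (\<integral>z. f z \<partial>\<pi>) \<in> U} | (f :: real \<times> real \<Rightarrow> real) U.
        continuous_on UNIV f \<and> bounded (range f) \<and> open U}"
  then obtain f :: "real \<times> real \<Rightarrow> real" and U where
    W: "W = {\<pi> \<in> borel_probs. (\<integral>z. f z \<partial>\<pi>) \<in> U}" and f: "continuous_on UNIV f" "bounded (range f)" "open U"
    by auto
  have "coupling_of -` W \<inter> bimeasures \<mu> \<nu> = bimeasures \<mu> \<nu> \<inter> (\<lambda>\<beta>. \<integral>z. f z \<partial>coupling_of \<beta>) -` U"
    using probs by (auto simp: W)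
  then show "openin (top_of_set (bimeasures \<mu> \<nu>)) (coupling_of -` W \<inter> topspace (top_of_set (bimeasures \<mu> \<nu>)))"
    using continuous_openin_preimage_gen[OF continuous_on_integral_coupling_of[OF f(1,2)] f(3)] by simp
qed

text \<open>
  Inside the compact set of bimeasures, the inequality \<open>cost \<le> c\<close> is an intersection of closed
  conditions; the coupling map carries it onto the sublevel set.
\<close>

lemma compactin_cost_sublevel:
  "compactin weak_topology {\<pi> \<in> couplings \<mu> \<nu>. martingale_cost \<mu> \<pi> \<le> c}"
proof -
  let ?K = "bimeasures \<mu> \<nu>"
  let ?T = "{\<beta> \<in> ?K. \<forall>A\<in>sets borel. signed_displacement A (coupling_of \<beta>) \<le> c}"
  have T_eq: "?T = (\<Inter>A\<in>sets borel. ?K \<inter> (\<lambda>\<beta>. signed_displacement A (coupling_of \<beta>)) -` {..c})"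
    using sets.empty_sets[of borel] by blast
  have "closedin (top_of_set ?K) ?T"
    unfolding T_eq
    by (intro closedin_INT continuous_closedin_preimage continuous_on_signed_displacement) auto
  then have "compact ?T"
    using compact_bimeasures closedin_compact by blast
  then have "compactin (top_of_set ?K) ?T"
    by (subst compactin_subtopology) auto
  then have "compactin weak_topology (coupling_of ` ?T)"
    using continuous_map_coupling_of by (rule image_compactin)
  also have "coupling_of ` ?T = {\<pi> \<in> couplings \<mu> \<nu>. martingale_cost \<mu> \<pi> \<le> c}"
  proof (intro equalityI subsetI)
    fix \<pi> assume "\<pi> \<in> coupling_of ` ?T"
    then show "\<pi> \<in> {\<pi> \<in> couplings \<mu> \<nu>. martingale_cost \<mu> \<pi> \<le> c}"
      using coupling_of(1) by (auto simp: martingale_cost_le_iff)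
  next
    fix \<pi> assume \<pi>: "\<pi> \<in> {\<pi> \<in> couplings \<mu> \<nu>. martingale_cost \<mu> \<pi> \<le> c}"
    then obtain \<beta> where "\<beta> \<in> ?K" "coupling_of \<beta> = \<pi>"
      using coupling_of_surj by blast
    then show "\<pi> \<in> coupling_of ` ?T"
      using \<pi> by (auto simp: martingale_cost_le_iff intro!: image_eqI[of _ _ \<beta>])
  qed
  finally show ?thesis .
qed

end

section \<open>The minimisers\<close>

text \<open>
  If a minimiser exists, the minimisers are the couplings whose cost is at most its cost.
\<close>

theorem lemma4p1:
  fixes \<mu> \<nu> :: "real measure"
  assumes "prob_space \<mu>" and "sets \<mu> = sets borel"
    and "prob_space \<nu>" and "sets \<nu> = sets borel"
    and "integrable \<mu> (\<lambda>x. x)" and "integrable \<nu> (\<lambda>y. y)"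
  shows "convex_measures (optimal_couplings \<mu> \<nu>) \<and>
         compactin weak_topology (optimal_couplings \<mu> \<nu>)"
proof (cases "optimal_couplings \<mu> \<nu> = {}")
  case True
  then show ?thesis by (simp add: convex_measures_def)
next
  case False
  interpret real_marginals \<mu> \<nu>
    using assms by (simp add: real_marginals_def real_marginals_axioms_def)
  obtain \<pi>0 where "\<pi>0 \<in> optimal_couplings \<mu> \<nu>"
    using False by blast
  then have "optimal_couplings \<mu> \<nu> = {\<pi> \<in> couplings \<mu> \<nu>. martingale_cost \<mu> \<pi> \<le> martingale_cost \<mu> \<pi>0}"
    unfolding optimal_couplings_def is_arg_min_linorder by (auto intro: order_trans)
  then show ?thesis
    using convex_cost_sublevel compactin_cost_sublevel by simp
qed

end
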